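(* Let $\sigma$ be a complex polynomial of degree $\le2$, $\sigma\ne0$, $\kappa$ a complex polynomial of degree $\le1$, and let $\rho$ be a nonzero solution of $(\sigma(z)\partial_z-\kappa(z))\rho(z)=0$. Define the transformation $T$ on $\mathcal{A}(\Omega)$ by $$(Tg)(t,s,z):=\rho(z)\,g(s,t,z).$$ Then $$TNT^{-1}=-N,\qquad TA_+T^{-1}=A_-,\qquad TA_-T^{-1}=A_+,\qquad T\mathcal{C}T^{-1}=\mathcal{C},$$ where in each identity the operators on the left-hand side (conjugated by $T$) are those associated with $(\sigma,\kappa)$, and the operators on the right-hand side are those associated with $(\sigma,-\kappa)$.
   Context: $\Omega$ is the universal cover of $\{(t,s,z)\in\mathbb{C}^3:\ \sigma(z)-ts=0,\ t\ne0,\ s\neq0\}$ and $\mathcal{A}(\Omega)$ is the space of analytic functions on $\Omega$. The operators associated with $(\sigma,\kappa)$ are $$N=t\partial_t-s\partial_s,\quad A_+=t\partial_z+\sigma'(z)\partial_s,\quad A_-=s\partial_z+\sigma'(z)\partial_t+\frac{\kappa(z)}{t}.$$ They commute with multiplication by $\sigma(z)-ts$ and hence act on $\mathcal{A}(\Omega)$; in the coordinates $w=t$, $z$ on $\Omega$ they read $N=w\partial_w$, $A_+=w\partial_z$, $A_-=\frac1w(\sigma(z)\partial_z+\sigma'(z)w\partial_w+\kappa(z))$. The Casimir operator associated with $(\sigma,\kappa)$ is $$\mathcal{C}=\tfrac12(A_-A_++A_+A_-)+\tfrac{\sigma''}{2}N^2+\kappa'N.$$ The operators associated with $(\sigma,-\kappa)$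 are obtained by replacing $\kappa$ with $-\kappa$. The function $\rho$ is analytic and nowhere zero on the universal cover $\Theta$ of $\mathbb{C}\setminus\{\text{zeros of }\sigma\}$, and is regarded as a function on $\Omega$. The swap $(t,s,z)\mapsto(s,t,z)$ is understood as an involution of $\Omega$ lifting the swap on the base manifold: in coordinates it is $(w,z)\mapsto(\sigma(z)/w,z)$, i.e. $\log w\mapsto\log\sigma(z)-\log w$ with a fixed branch of $\log\sigma$ on $\Theta$. Thus $Tg(w,z)=\rho(z)g(\sigma(z)/w,z)$. *)

theory Defs
  imports "HOL-Analysis.Analysis" "HOL-Computational_Algebra.Polynomial"
begin

section \<open>Universal covers and analytic functions on them\<close>

definition universal_cover ::
    "'a::topological_space set \<Rightarrow> ('a \<Rightarrow> 'b::topological_space) \<Rightarrow> 'b set \<Rightarrow> bool" where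
  "universal_cover M p S \<longleftrightarrow> covering_space M p S \<and> simply_connected M"

text \<open>
  Holomorphy in three variables: total complex differentiability, i.e. a complex linear
  Frechet derivative at every point of an open set.
\<close>
definition holomorphic3_on :: "(complex \<times> complex \<times> complex \<Rightarrow> complex) \<Rightarrow>
    (complex \<times> complex \<times> complex) set \<Rightarrow> bool" where
  "holomorphic3_on F W \<longleftrightarrow> open W \<and>
     (\<forall>u\<in>W. \<exists>a b c. (F has_derivative (\<lambda>(t, s, z). a * t + b * s + c * z)) (at u))"

text \<open>
  A covering \<open>p\<close> from \<open>M\<close> onto a complex submanifold \<open>S\<close> of \<open>\<complex>\<close> or \<open>\<complex>\<^sup>3\<close> gives \<open>M\<close> the complex
  structure pulled back from \<open>S\<close>; a function on \<open>S\<close> is analytic iff it is locally the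
  restriction of an analytic function of the ambient variables.  Here \<open>F\<close> is such an ambient
  representative of \<open>f\<close> near \<open>x\<close>.  The argument \<open>hol\<close> is the notion of holomorphy on open
  subsets of the ambient space.
\<close>
definition local_rep :: "(('e::topological_space \<Rightarrow> complex) \<Rightarrow> 'e set \<Rightarrow> bool) \<Rightarrow>
    'a::topological_space set \<Rightarrow> ('a \<Rightarrow> 'e) \<Rightarrow> ('a \<Rightarrow> complex) \<Rightarrow> 'a \<Rightarrow> ('e \<Rightarrow> complex) \<Rightarrow> bool" where
  "local_rep hol M p f x F \<longleftrightarrow>
     (\<exists>V W. openin (top_of_set M) V \<and> x \<in> V \<and> open W \<and> p ` V \<subseteq> W \<and> hol F W \<and>
            (\<forall>y\<in>V. f y = F (p y)))"

text \<open>
  Functions on \<open>M\<close> are \<open>extensional\<close>, so that equality of functions is equality on \<open>M\<close>.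
\<close>
definition analytic_funs :: "(('e::topological_space \<Rightarrow> complex) \<Rightarrow> 'e set \<Rightarrow> bool) \<Rightarrow>
    'a::topological_space set \<Rightarrow> ('a \<Rightarrow> 'e) \<Rightarrow> ('a \<Rightarrow> complex) set" where
  "analytic_funs hol M p = {f \<in> extensional M. \<forall>x\<in>M. \<exists>F. local_rep hol M p f x F}"

text \<open>
  The operator on functions on \<open>M\<close> induced by a differential operator \<open>D\<close> in the ambient
  variables: apply \<open>D\<close> to a local ambient representative.  The value does not depend on the
  representative when \<open>D\<close> is tangential to \<open>S\<close> (commutes with multiplication by its defining
  function), as is the case wherever it is used below.
\<close>
definition induced_op :: "(('e::topological_space \<Rightarrow> complex) \<Rightarrow> 'e set \<Rightarrow> bool) \<Rightarrow>
    'a::topological_space set \<Rightarrow> ('a \<Rightarrow> 'e) \<Rightarrow>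
    (('e \<Rightarrow> complex) \<Rightarrow> 'e \<Rightarrow> complex) \<Rightarrow> ('a \<Rightarrow> complex) \<Rightarrow> ('a \<Rightarrow> complex)" where
  "induced_op hol M p D f =
     (\<lambda>x\<in>M. THE c. \<exists>F. local_rep hol M p f x F \<and> c = D F (p x))"


section \<open>The spaces \<open>\<Omega>\<close> and \<open>\<Theta>\<close>\<close>

definition base_surface :: "complex poly \<Rightarrow> (complex \<times> complex \<times> complex) set" where
  "base_surface \<sigma> = {(t, s, z). poly \<sigma> z - t * s = 0 \<and> t \<noteq> 0 \<and> s \<noteq> 0}"

definition swap_ts :: "complex \<times> complex \<times> complex \<Rightarrow> complex \<times> complex \<times> complex" where
  "swap_ts = (\<lambda>(t, s, z). (s, t, z))"

abbreviation coord_t :: "complex \<times> complex \<times> complex \<Rightarrow> complex" where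
  "coord_t u \<equiv> fst u"

abbreviation coord_z :: "complex \<times> complex \<times> complex \<Rightarrow> complex" where
  "coord_z u \<equiv> snd (snd u)"

abbreviation space_A :: "'a::topological_space set \<Rightarrow> ('a \<Rightarrow> complex \<times> complex \<times> complex) \<Rightarrow>
    ('a \<Rightarrow> complex) set" where
  "space_A \<equiv> analytic_funs holomorphic3_on"

abbreviation space_A\<Theta> :: "'b::topological_space set \<Rightarrow> ('b \<Rightarrow> complex) \<Rightarrow> ('b \<Rightarrow> complex) set" where
  "space_A\<Theta> \<equiv> analytic_funs (\<lambda>f W. f holomorphic_on W)"

text \<open>\<open>\<partial>\<^sub>z\<close> on the universal cover \<open>q\<close> from \<open>\<Theta>\<close> onto the complement of the zeros of \<open>\<sigma>\<close>.\<close>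
definition dz_\<Theta> :: "'b::topological_space set \<Rightarrow> ('b \<Rightarrow> complex) \<Rightarrow>
    ('b \<Rightarrow> complex) \<Rightarrow> ('b \<Rightarrow> complex)" where
  "dz_\<Theta> \<Theta> q = induced_op (\<lambda>f W. f holomorphic_on W) \<Theta> q deriv"

text \<open>
  The coordinates on \<open>\<Omega>\<close>: \<open>\<zeta>\<close> lifts the function \<open>z\<close> to a map from \<open>\<Omega>\<close> to \<open>\<Theta>\<close> (functions of \<open>z\<close>
  on \<open>\<Theta>\<close> are regarded as functions on \<open>\<Omega>\<close> by composition with \<open>\<zeta>\<close>), and \<open>lw\<close> is a logarithm
  of \<open>w = t\<close>.
\<close>
definition cover_coordinates :: "'a::topological_space set \<Rightarrow>
    ('a \<Rightarrow> complex \<times> complex \<times> complex) \<Rightarrow> 'b::topological_space set \<Rightarrow> ('b \<Rightarrow> complex) \<Rightarrow>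
    ('a \<Rightarrow> complex) \<Rightarrow> ('a \<Rightarrow> 'b) \<Rightarrow> bool" where
  "cover_coordinates \<Omega> p \<Theta> q lw \<zeta> \<longleftrightarrow>
     continuous_on \<Omega> \<zeta> \<and> \<zeta> \<in> \<Omega> \<rightarrow> \<Theta> \<and> (\<forall>x\<in>\<Omega>. q (\<zeta> x) = coord_z (p x)) \<and>
     continuous_on \<Omega> lw \<and> (\<forall>x\<in>\<Omega>. exp (lw x) = coord_t (p x))"

definition log_branch :: "complex poly \<Rightarrow> 'b::topological_space set \<Rightarrow> ('b \<Rightarrow> complex) \<Rightarrow>
    ('b \<Rightarrow> complex) \<Rightarrow> bool" where
  "log_branch \<sigma> \<Theta> q L \<longleftrightarrow> continuous_on \<Theta> L \<and> (\<forall>\<theta>\<in>\<Theta>. exp (L \<theta>) = poly \<sigma> (q \<theta>))"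

definition lifted_swap :: "'a::topological_space set \<Rightarrow>
    ('a \<Rightarrow> complex \<times> complex \<times> complex) \<Rightarrow> ('a \<Rightarrow> complex) \<Rightarrow> ('a \<Rightarrow> 'b) \<Rightarrow>
    ('b \<Rightarrow> complex) \<Rightarrow> ('a \<Rightarrow> 'a) \<Rightarrow> bool" where
  "lifted_swap \<Omega> p lw \<zeta> L \<tau> \<longleftrightarrow>
     continuous_on \<Omega> \<tau> \<and> \<tau> \<in> \<Omega> \<rightarrow> \<Omega> \<and> (\<forall>x\<in>\<Omega>. \<tau> (\<tau> x) = x) \<and>
     (\<forall>x\<in>\<Omega>. p (\<tau> x) = swap_ts (p x)) \<and>
     (\<forall>x\<in>\<Omega>. \<zeta> (\<tau> x) = \<zeta> x \<and> lw (\<tau> x) = L (\<zeta> x) - lw x)"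


section \<open>The operators\<close>

definition d_t :: "(complex \<times> complex \<times> complex \<Rightarrow> complex) \<Rightarrow> complex \<times> complex \<times> complex \<Rightarrow> complex" where
  "d_t F = (\<lambda>(t, s, z). deriv (\<lambda>v. F (v, s, z)) t)"

definition d_s :: "(complex \<times> complex \<times> complex \<Rightarrow> complex) \<Rightarrow> complex \<times> complex \<times> complex \<Rightarrow> complex" where
  "d_s F = (\<lambda>(t, s, z). deriv (\<lambda>v. F (t, v, z)) s)"

definition d_z :: "(complex \<times> complex \<times> complex \<Rightarrow> complex) \<Rightarrow> complex \<times> complex \<times> complex \<Rightarrow> complex" where
  "d_z F = (\<lambda>(t, s, z). deriv (\<lambda>v. F (t, s, v)) z)"

definition op_N :: "'a::topological_space set \<Rightarrow> ('a \<Rightarrow> complex \<times> complex \<times> complex) \<Rightarrow>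
    ('a \<Rightarrow> complex) \<Rightarrow> ('a \<Rightarrow> complex)" where
  "op_N \<Omega> p = induced_op holomorphic3_on \<Omega> p
     (\<lambda>F (t, s, z). t * d_t F (t, s, z) - s * d_s F (t, s, z))"

definition op_A_plus :: "complex poly \<Rightarrow> 'a::topological_space set \<Rightarrow>
    ('a \<Rightarrow> complex \<times> complex \<times> complex) \<Rightarrow> ('a \<Rightarrow> complex) \<Rightarrow> ('a \<Rightarrow> complex)" where
  "op_A_plus \<sigma> \<Omega> p = induced_op holomorphic3_on \<Omega> p
     (\<lambda>F (t, s, z). t * d_z F (t, s, z) + poly (pderiv \<sigma>) z * d_s F (t, s, z))"

definition op_A_minus :: "complex poly \<Rightarrow> complex poly \<Rightarrow> 'a::topological_space set \<Rightarrow>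
    ('a \<Rightarrow> complex \<times> complex \<times> complex) \<Rightarrow> ('a \<Rightarrow> complex) \<Rightarrow> ('a \<Rightarrow> complex)" where
  "op_A_minus \<sigma> \<kappa> \<Omega> p = induced_op holomorphic3_on \<Omega> p
     (\<lambda>F (t, s, z). s * d_z F (t, s, z) + poly (pderiv \<sigma>) z * d_t F (t, s, z)
                     + poly \<kappa> z / t * F (t, s, z))"

definition casimir :: "complex poly \<Rightarrow> complex poly \<Rightarrow> 'a::topological_space set \<Rightarrow>
    ('a \<Rightarrow> complex \<times> complex \<times> complex) \<Rightarrow> ('a \<Rightarrow> complex) \<Rightarrow> ('a \<Rightarrow> complex)" where
  "casimir \<sigma> \<kappa> \<Omega> p f = (\<lambda>x\<in>\<Omega>.
     1 / 2 * (op_A_minus \<sigma> \<kappa> \<Omega> p (op_A_plus \<sigma> \<Omega> p f) x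
              + op_A_plus \<sigma> \<Omega> p (op_A_minus \<sigma> \<kappa> \<Omega> p f) x)
     + poly (pderiv (pderiv \<sigma>)) (coord_z (p x)) / 2 * op_N \<Omega> p (op_N \<Omega> p f) x
     + poly (pderiv \<kappa>) (coord_z (p x)) * op_N \<Omega> p f x)"

definition op_T :: "'a set \<Rightarrow> ('a \<Rightarrow> 'b) \<Rightarrow> ('a \<Rightarrow> 'a) \<Rightarrow> ('b \<Rightarrow> complex) \<Rightarrow>
    ('a \<Rightarrow> complex) \<Rightarrow> ('a \<Rightarrow> complex)" where
  "op_T \<Omega> \<zeta> \<tau> \<rho> g = (\<lambda>x\<in>\<Omega>. \<rho> (\<zeta> x) * g (\<tau> x))"

end

theory Submission
  imports Defs "HOL-Complex_Analysis.Complex_Analysis"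
begin

text \<open>
  Near a point of \<open>\<Omega>\<close> a representative of \<open>Tf\<close> is \<open>R(z) F(s, t, z)\<close>, with \<open>R\<close>, \<open>F\<close> representing
  \<open>\<rho>\<close> and \<open>f\<close>; the first-order identities are then the chain rule together with
  \<open>ts \<rho>' = \<sigma> \<rho>' = \<kappa> \<rho>\<close>, and the Casimir identity follows by composing them.  Three analytic facts are
  needed: an operator does not depend on the representative, because it differentiates along the
  surface; its values are again analytic, because the partial derivatives of a differentiable
  function of three complex variables are differentiable (Cauchy's formula and the Leibniz rule);
  and \<open>\<rho>\<close> has no zeros on the connected space \<open>\<Theta>\<close>, by uniqueness for the linear equation.
\<close>

section \<open>Holomorphic functions of three variables\<close>

text \<open>Three-variable holomorphy assumes a complex derivative at each point and no continuity
  of the partial derivatives. Cauchy's formula on complex lines is therefore used twice: it first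
  gives a continuous gradient, and only then is differentiation under the integral sign legitimate.
  The resulting smoothness is what makes the compositions in the Casimir meaningful. The sign change
  of \<kappa> comes from the pole. The swap carries the term \<kappa>/t of A_- to \<kappa>/s, which
  on ts = \<sigma> equals t \<rho>'/\<rho>: exactly what A_+ produces when its z-derivative hits the
  multiplier. Conversely, s \<partial>_z applied to the multiplier leaves s \<rho>'/\<rho> =
  \<kappa>/t, while A_+ has no zeroth-order term; so A_- must carry -\<kappa>/t to cancel it. The
  swap fixes z and is an involution, so the inverse of T is a map of the same shape with multiplier
  1/\<rho>.\<close>

fun lin3 :: "complex \<times> complex \<times> complex \<Rightarrow> complex \<times> complex \<times> complex \<Rightarrow> complex" where
  "lin3 (a, b, c) (t, s, z) = a * t + b * s + c * z"

text \<open>\<open>scaleR\<close> scales triples by reals only; the complex lines u + v e require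
  complex v.\<close>

fun cscale :: "complex \<Rightarrow> complex \<times> complex \<times> complex \<Rightarrow> complex \<times> complex \<times> complex" where
  "cscale v (t, s, z) = (v * t, v * s, v * z)"

definition grad3 :: "(complex \<times> complex \<times> complex \<Rightarrow> complex) \<Rightarrow>
    complex \<times> complex \<times> complex \<Rightarrow> complex \<times> complex \<times> complex" where
  "grad3 F u = (d_t F u, d_s F u, d_z F u)"

lemma lin3_alt: "lin3 g = (\<lambda>(t, s, z). fst g * t + fst (snd g) * s + snd (snd g) * z)"
  by (cases g) auto

lemma cscale_alt: "cscale v e = (v * fst e, v * fst (snd e), v * snd (snd e))"
  by (cases e) auto

lemma continuous_on_cscale [continuous_intros]:
  assumes "continuous_on X f" "continuous_on X g"
  shows "continuous_on X (\<lambda>y. cscale (f y) (g y))"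
  unfolding cscale_alt by (intro continuous_intros assms)

lemma norm_cscale: "norm (cscale v e) = norm v * norm e"
  by (cases e)
    (simp add: norm_Pair norm_mult power_mult_distrib real_sqrt_mult flip: distrib_left)

lemma has_field_derivative_along:
  assumes "(F has_derivative lin3 g) (at (\<gamma> x))" and "(\<gamma> has_derivative (\<lambda>v. cscale v e)) (at x)"
  shows "((\<lambda>v. F (\<gamma> v)) has_field_derivative lin3 g e) (at x)"
proof -
  have "((\<lambda>v. F (\<gamma> v)) has_derivative (\<lambda>v. lin3 g (cscale v e))) (at x)"
    using has_derivative_compose[OF assms(2,1)] .
  moreover have "(\<lambda>v. lin3 g (cscale v e)) = (*) (lin3 g e)"
    by (cases g; cases e) (auto simp: algebra_simps)
  ultimately show ?thesis
    by (simp add: has_field_derivative_def)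
qed

text \<open>Restricting to the three coordinate lines reads off the coefficients. Hence one total
  derivative, found by the chain or product rule, yields all partial derivatives at once.\<close>

lemma grad3_eq:
  assumes "(F has_derivative lin3 g) (at u)"
  shows "grad3 F u = g"
proof -
  obtain t s z where u: "u = (t, s, z)" by (cases u) auto
  obtain a b c where g: "g = (a, b, c)" by (cases g) auto
  have "((\<lambda>v. (v, s, z)) has_derivative (\<lambda>v. cscale v (1, 0, 0))) (at t)"
    "((\<lambda>v. (t, v, z)) has_derivative (\<lambda>v. cscale v (0, 1, 0))) (at s)"
    "((\<lambda>v. (t, s, v)) has_derivative (\<lambda>v. cscale v (0, 0, 1))) (at z)"
    by (auto intro!: derivative_eq_intros simp: zero_prod_def)
  from this[THEN has_field_derivative_along[rotated], of F g] assms show ?thesis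
    by (simp add: u g grad3_def d_t_def d_s_def d_z_def DERIV_imp_deriv)
qed

lemma holomorphic3_on_iff:
  "holomorphic3_on F W \<longleftrightarrow> open W \<and> (\<forall>u\<in>W. (F has_derivative lin3 (grad3 F u)) (at u))"
proof -
  have "(\<exists>a b c. (F has_derivative (\<lambda>(t, s, z). a * t + b * s + c * z)) (at u)) \<longleftrightarrow>
      (\<exists>g. (F has_derivative lin3 g) (at u))" for u
    by (auto simp: lin3_alt)
  then show ?thesis
    unfolding holomorphic3_on_def using grad3_eq by metis
qed

lemma holomorphic3_on_imp_continuous_on: "holomorphic3_on F W \<Longrightarrow> continuous_on W F"
  unfolding holomorphic3_on_iff
  by (auto intro!: continuous_at_imp_continuous_on dest: has_derivative_continuous)

section \<open>Cauchy's formula along complex lines\<close>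

text \<open>The slice v \<mapsto> F (u + v e) is holomorphic in one variable, and its derivative at
  0 is the derivative of F at u in direction e.\<close>

lemma Cauchy_directional_derivative:
  assumes F: "holomorphic3_on F W" and r: "0 < r"
    and W: "\<And>v. norm v \<le> r \<Longrightarrow> u + cscale v e \<in> W"
  defines "c \<equiv> \<lambda>x::real. of_real r * exp (2 * of_real pi * \<i> * of_real x)"
  shows "lin3 (grad3 F u) e = integral {0..1} (\<lambda>x. F (u + cscale (c x) e) / c x)"
proof -
  define f where "f = (\<lambda>v. F (u + cscale v e))"
  have der: "(f has_field_derivative lin3 (grad3 F (u + cscale v e)) e) (at v)"
    if "norm v \<le> r" for v
    unfolding f_def
  proof (rule has_field_derivative_along)
    show "(F has_derivative lin3 (grad3 F (u + cscale v e))) (at (u + cscale v e))"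
      using F W[OF that] by (auto simp: holomorphic3_on_iff)
    show "((\<lambda>v. u + cscale v e) has_derivative (\<lambda>v. cscale v e)) (at v)"
      by (auto intro!: derivative_eq_intros simp: cscale_alt)
  qed
  have "u + cscale 0 e = u"
    by (cases u; cases e) auto
  with der[of 0] r have d0: "(f has_field_derivative lin3 (grad3 F u) e) (at 0)"
    by simp
  have cont: "continuous_on (cball 0 r) f"
    using der by (meson DERIV_isCont continuous_at_imp_continuous_on mem_cball_0)
  have hol: "f holomorphic_on ball 0 r"
    unfolding holomorphic_on_open[OF open_ball] using der by (metis less_imp_le mem_ball_0)
  have "(f has_field_derivative 1 / (2 * of_real pi * \<i>) *
      contour_integral (circlepath 0 r) (\<lambda>v. f v / (v - 0)^2)) (at 0)"
    using Cauchy_derivative_integral_circlepath(2)[OF cont hol, of 0] r by simp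
  then have "lin3 (grad3 F u) e =
      1 / (2 * of_real pi * \<i>) * contour_integral (circlepath 0 r) (\<lambda>v. f v / (v - 0)^2)"
    using d0 DERIV_unique by blast
  \<comment> \<open>On the circle c' = 2 pi i c, so c'/c^2 = 2 pi i/c; this constant cancels the
    prefactor of Cauchy's formula.\<close>
  also have "contour_integral (circlepath 0 r) (\<lambda>v. f v / (v - 0)^2) =
      integral {0..1} (\<lambda>x. 2 * of_real pi * \<i> * (f (c x) / c x))"
    unfolding contour_integral_integral vector_derivative_circlepath
    by (rule integral_cong) (use r in \<open>simp add: circlepath c_def power2_eq_square field_simps\<close>)
  also have "\<dots> = 2 * of_real pi * \<i> * integral {0..1} (\<lambda>x. f (c x) / c x)"
    by (rule integral_mult_right)
  finally show ?thesis
    by (simp add: f_def)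
qed

text \<open>Over a small ball the integration circle can be kept fixed while the centre moves.\<close>
lemma Cauchy_directional_derivative_ball:
  assumes F: "holomorphic3_on F W" and u0: "u0 \<in> W"
  obtains c :: "real \<Rightarrow> complex" and d where "0 < d" "ball u0 d \<subseteq> W"
    "continuous_on UNIV c" "\<And>x. c x \<noteq> 0"
    "\<And>u x. u \<in> ball u0 d \<Longrightarrow> u + cscale (c x) e \<in> W"
    "\<And>u. u \<in> ball u0 d \<Longrightarrow>
      lin3 (grad3 F u) e = integral {0..1} (\<lambda>x. F (u + cscale (c x) e) / c x)"
proof -
  obtain R where R: "R > 0" "ball u0 R \<subseteq> W"
    using F u0 unfolding holomorphic3_on_iff open_contains_ball by blast
  \<comment> \<open>Half of R is left for the moving centre and half for the circle, whose points
    lie at distance r * norm e <= R/2 from it. The summand 1 covers e = 0.\<close>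
  define r where "r = R / 2 / (norm e + 1)"
  have r: "r > 0"
    using R by (simp add: r_def add_nonneg_pos)
  define c where "c = (\<lambda>x::real. of_real r * exp (2 * of_real pi * \<i> * of_real x))"
  have W: "u + cscale v e \<in> W" if "u \<in> ball u0 (R / 2)" "norm v \<le> r" for u v
  proof -
    have "norm (cscale v e) \<le> r * norm e"
      unfolding norm_cscale using that by (intro mult_right_mono) auto
    also have "\<dots> \<le> r * (norm e + 1)"
      using r by simp
    also have "\<dots> = R / 2"
      unfolding r_def using norm_ge_zero[of e] by (simp add: field_simps del: norm_ge_zero)
    finally have "dist (u + cscale v e) u0 < R"
      using that(1) norm_triangle_ineq[of "u - u0" "cscale v e"]
      by (simp add: dist_norm norm_minus_commute algebra_simps)
    then show ?thesis
      using R by (auto simp: dist_commute)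
  qed
  have nc: "norm (c x) = r" for x
    using r by (simp add: c_def norm_mult)
  show ?thesis
  proof
    show "0 < R / 2" "ball u0 (R / 2) \<subseteq> W"
      using R by auto
    show "continuous_on UNIV c"
      unfolding c_def by (intro continuous_intros)
    show "c x \<noteq> 0" for x
      using nc[of x] r by auto
    show "u + cscale (c x) e \<in> W" if "u \<in> ball u0 (R / 2)" for u x
      using W[OF that] nc by simp
    show "lin3 (grad3 F u) e = integral {0..1} (\<lambda>x. F (u + cscale (c x) e) / c x)"
      if "u \<in> ball u0 (R / 2)" for u
      unfolding c_def by (rule Cauchy_directional_derivative[OF F r]) (use W that in auto)
  qed
qed

text \<open>The Cauchy integrand involves only F itself and is jointly continuous in centre and
  parameter. This continuity is the hypothesis that the Leibniz rule will need.\<close>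

lemma continuous_on_directional_derivative:
  assumes F: "holomorphic3_on F W"
  shows "continuous_on W (\<lambda>u. lin3 (grad3 F u) e)"
proof -
  have W: "open W"
    using F by (simp add: holomorphic3_on_iff)
  have "isCont (\<lambda>u. lin3 (grad3 F u) e) u0" if u0: "u0 \<in> W" for u0
  proof -
    obtain d c where cd: "0 < d" "ball u0 d \<subseteq> W" "continuous_on UNIV c" "\<And>x::real. c x \<noteq> 0"
      "\<And>u x. u \<in> ball u0 d \<Longrightarrow> u + cscale (c x) e \<in> W"
      "\<And>u. u \<in> ball u0 d \<Longrightarrow>
        lin3 (grad3 F u) e = integral {0..1} (\<lambda>x. F (u + cscale (c x) e) / c x)"
      by (rule Cauchy_directional_derivative_ball[OF F u0, of e]) (rule that)
    have c: "continuous_on X (\<lambda>y. c (snd y))" for X :: "((complex \<times> complex \<times> complex) \<times> real) set"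
      by (rule continuous_on_compose2[OF cd(3)]) (auto intro: continuous_intros)
    have "continuous_on (ball u0 d \<times> cbox 0 1) (\<lambda>y. F (fst y + cscale (c (snd y)) e) / c (snd y))"
      by (intro continuous_intros c continuous_on_compose2[OF holomorphic3_on_imp_continuous_on[OF F]])
        (use cd(4,5) in auto)
    then have "continuous_on (ball u0 d) (\<lambda>u. integral (cbox 0 1) (\<lambda>x. F (u + cscale (c x) e) / c x))"
      by (intro integral_continuous_on_param) (simp add: case_prod_beta)
    then have "continuous_on (ball u0 d) (\<lambda>u. lin3 (grad3 F u) e)"
      by (subst continuous_on_cong[OF refl cd(6)]) auto
    then show ?thesis
      using cd(1) by (simp add: continuous_on_eq_continuous_at)
  qed
  then show ?thesis
    using W by (simp add: continuous_on_eq_continuous_at)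
qed

lemma continuous_on_grad3:
  assumes F: "holomorphic3_on F W"
  shows "continuous_on W (grad3 F)"
proof -
  have "grad3 F = (\<lambda>u. (lin3 (grad3 F u) (1, 0, 0), lin3 (grad3 F u) (0, 1, 0), lin3 (grad3 F u) (0, 0, 1)))"
    by (simp add: grad3_def fun_eq_iff)
  show ?thesis
    by (subst \<open>grad3 F = _\<close>) (intro continuous_on_Pair continuous_on_directional_derivative[OF F])
qed

section \<open>Differentiation under the integral sign\<close>

text \<open>\<open>lin3\<close> as a bounded linear map, the form in which the Leibniz rule takes a
  derivative depending continuously on a parameter.\<close>

definition blin3 :: "complex \<times> complex \<times> complex \<Rightarrow> (complex \<times> complex \<times> complex) \<Rightarrow>\<^sub>L complex" where
  "blin3 g = (blinfun_mult_right (fst g) o\<^sub>L fst_blinfun)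
    + (blinfun_mult_right (fst (snd g)) o\<^sub>L fst_blinfun o\<^sub>L snd_blinfun)
    + (blinfun_mult_right (snd (snd g)) o\<^sub>L snd_blinfun o\<^sub>L snd_blinfun)"

lemma blin3_apply: "blinfun_apply (blin3 g) = lin3 g"
  by (auto simp: blin3_def lin3_alt blinfun.bilinear_simps fun_eq_iff)

lemma continuous_on_blin3 [continuous_intros]:
  "continuous_on X f \<Longrightarrow> continuous_on X (\<lambda>y. blin3 (f y))"
  unfolding blin3_def
  by (intro continuous_intros bounded_linear.continuous_on[OF bounded_linear_blinfun_mult_right])

text \<open>Integrating the coefficients shows that complex linearity survives integration.\<close>

lemma integral_lin3:
  assumes "continuous_on {0..1::real} g"
  shows "integral {0..1} (\<lambda>x. lin3 (g x) h) =
    lin3 (integral {0..1} (\<lambda>x. fst (g x)), integral {0..1} (\<lambda>x. fst (snd (g x))),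
      integral {0..1} (\<lambda>x. snd (snd (g x)))) h"
proof -
  have "(\<lambda>x. fst (g x)) integrable_on {0..1}" "(\<lambda>x. fst (snd (g x))) integrable_on {0..1}"
    "(\<lambda>x. snd (snd (g x))) integrable_on {0..1}"
    using assms by (auto intro!: integrable_continuous_real continuous_intros)
  then show ?thesis
    by (cases h) (simp add: lin3_alt integral_add integrable_add integrable_on_mult_left)
qed

text \<open>The Cauchy integral represents the directional derivative with a fixed circle, so it can
  be differentiated with respect to the centre under the integral sign.\<close>

lemma holomorphic3_on_directional_derivative:
  assumes F: "holomorphic3_on F W"
  shows "holomorphic3_on (\<lambda>u. lin3 (grad3 F u) e) W"
proof -
  have W: "open W" and der: "\<And>u. u \<in> W \<Longrightarrow> (F has_derivative lin3 (grad3 F u)) (at u)"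
    using F by (auto simp: holomorphic3_on_iff)
  have "\<exists>g. ((\<lambda>u. lin3 (grad3 F u) e) has_derivative lin3 g) (at u0)" if u0: "u0 \<in> W" for u0
  proof -
    obtain d c where cd: "0 < d" "ball u0 d \<subseteq> W" "continuous_on UNIV c" "\<And>x::real. c x \<noteq> 0"
      "\<And>u x. u \<in> ball u0 d \<Longrightarrow> u + cscale (c x) e \<in> W"
      "\<And>u. u \<in> ball u0 d \<Longrightarrow>
        lin3 (grad3 F u) e = integral {0..1} (\<lambda>x. F (u + cscale (c x) e) / c x)"
      by (rule Cauchy_directional_derivative_ball[OF F u0, of e]) (rule that)
    have c: "continuous_on X (\<lambda>y. c (snd y))" for X :: "((complex \<times> complex \<times> complex) \<times> real) set"
      by (rule continuous_on_compose2[OF cd(3)]) (auto intro: continuous_intros)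
    have c': "continuous_on X c" for X
      using cd(3) continuous_on_subset by blast
    \<comment> \<open>The gradient of the Cauchy integrand with respect to the centre u.\<close>
    define G where "G = (\<lambda>u x. cscale (1 / c x) (grad3 F (u + cscale (c x) e)))"
    have lin: "lin3 (G u x) h = lin3 (grad3 F (u + cscale (c x) e)) h / c x" for u x h
      using cd(4)[of x] by (simp add: G_def lin3_alt cscale_alt case_prod_beta field_simps)
    have contG: "continuous_on (ball u0 d \<times> cbox 0 1) (\<lambda>y. G (fst y) (snd y))"
      unfolding G_def
      by (intro continuous_intros c continuous_on_compose2[OF continuous_on_grad3[OF F]])
        (use cd(4,5) in auto)
    have int: "(\<lambda>x. F (u + cscale (c x) e) / c x) integrable_on cbox 0 1" if "u \<in> ball u0 d" for u
      using that
      by (intro integrable_continuous continuous_intros c'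
          continuous_on_compose2[OF holomorphic3_on_imp_continuous_on[OF F]])
        (use cd(4) cd(5)[OF that] in auto)
    have dG: "((\<lambda>u. F (u + cscale (c x) e) / c x) has_derivative blinfun_apply (blin3 (G u x)))
        (at u within ball u0 d)" if "u \<in> ball u0 d" for u x
    proof -
      have "((\<lambda>u. F (u + cscale (c x) e)) has_derivative lin3 (grad3 F (u + cscale (c x) e))) (at u)"
        by (rule has_derivative_compose[of "\<lambda>u. u + cscale (c x) e" "\<lambda>h. h" u UNIV F,
              OF _ der[OF cd(5)[OF that]]])
          (auto intro!: derivative_eq_intros)
      then have "((\<lambda>u. F (u + cscale (c x) e) / c x) has_derivative
          (\<lambda>h. lin3 (grad3 F (u + cscale (c x) e)) h / c x)) (at u)"
        using bounded_linear.has_derivative[OF bounded_linear_divide] by blast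
      then show ?thesis
        by (simp add: blin3_apply lin[abs_def, symmetric] has_derivative_at_withinI)
    qed
    have "((\<lambda>u. integral (cbox 0 1) (\<lambda>x. F (u + cscale (c x) e) / c x)) has_derivative
        blinfun_apply (integral (cbox 0 1) (\<lambda>x. blin3 (G u0 x)))) (at u0 within ball u0 d)"
      by (rule leibniz_rule[OF dG int])
        (use cd(1) contG in \<open>auto simp: case_prod_beta intro!: continuous_intros\<close>)
    then have *: "((\<lambda>u. lin3 (grad3 F u) e) has_derivative
        blinfun_apply (integral (cbox 0 1) (\<lambda>x. blin3 (G u0 x)))) (at u0 within ball u0 d)"
      by (rule has_derivative_transform[rotated 2]) (use cd in auto)
    have cG: "continuous_on {0..1} (G u0)"
    proof -
      have "continuous_on {0..1} (\<lambda>x. G (fst (u0, x)) (snd (u0, x)))"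
        by (rule continuous_on_compose2[OF contG]) (use cd(1) in \<open>auto intro!: continuous_intros\<close>)
      then show ?thesis
        by simp
    qed
    have "(\<lambda>x. blin3 (G u0 x)) integrable_on {0..1}"
      by (intro integrable_continuous_real continuous_intros cG)
    \<comment> \<open>The Leibniz rule delivers merely a real bounded linear map; here it is
      recognised as complex linear.\<close>
    then have "\<exists>g. blinfun_apply (integral (cbox 0 1) (\<lambda>x. blin3 (G u0 x))) = lin3 g"
      by (intro exI ext)
        (simp add: blinfun_apply_integral blin3_apply integral_lin3[OF cG])
    with * show ?thesis
      using cd(1) by (metis at_within_open centre_in_ball open_ball)
  qed
  with W show ?thesis
    unfolding holomorphic3_on_iff using grad3_eq by blast
qed

lemma holomorphic3_on_partials:
  assumes "holomorphic3_on F W"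
  shows "holomorphic3_on (d_t F) W" "holomorphic3_on (d_s F) W" "holomorphic3_on (d_z F) W"
  using assms[THEN holomorphic3_on_directional_derivative, of "(1, 0, 0)"]
    assms[THEN holomorphic3_on_directional_derivative, of "(0, 1, 0)"]
    assms[THEN holomorphic3_on_directional_derivative, of "(0, 0, 1)"]
  by (simp_all add: grad3_def)

section \<open>Closure properties of three-variable holomorphy\<close>

lemma lin3_add: "lin3 (g + h) e = lin3 g e + lin3 h e"
  by (cases g; cases h; cases e) (simp add: algebra_simps)

lemma lin3_cscale: "lin3 (cscale v g) e = v * lin3 g e"
  by (cases g; cases e) (simp add: algebra_simps)

lemma lin3_uminus: "lin3 (- g) e = - lin3 g e"
  by (cases g; cases e) simp

lemma holomorphic3_onI:
  assumes "open W" "\<And>u. u \<in> W \<Longrightarrow> (F has_derivative lin3 (G u)) (at u)"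
  shows "holomorphic3_on F W"
  using assms grad3_eq unfolding holomorphic3_on_iff by metis

lemma holomorphic3_onD:
  "holomorphic3_on F W \<Longrightarrow> u \<in> W \<Longrightarrow> (F has_derivative lin3 (grad3 F u)) (at u)"
  by (simp add: holomorphic3_on_iff)

lemma holomorphic3_on_imp_open: "holomorphic3_on F W \<Longrightarrow> open W"
  by (simp add: holomorphic3_on_iff)

lemma holomorphic3_on_subset: "holomorphic3_on F W \<Longrightarrow> open W' \<Longrightarrow> W' \<subseteq> W \<Longrightarrow> holomorphic3_on F W'"
  by (auto simp: holomorphic3_on_iff)

lemma holomorphic3_on_add:
  assumes "holomorphic3_on F W" "holomorphic3_on G W"
  shows "holomorphic3_on (\<lambda>u. F u + G u) W"
proof (rule holomorphic3_onI)
  show "((\<lambda>u. F u + G u) has_derivative lin3 (grad3 F u + grad3 G u)) (at u)" if "u \<in> W" for u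
    using has_derivative_add[OF assms[THEN holomorphic3_onD, OF that]]
    by (simp add: lin3_add[abs_def])
qed (rule holomorphic3_on_imp_open[OF assms(1)])

lemma holomorphic3_on_mult:
  assumes "holomorphic3_on F W" "holomorphic3_on G W"
  shows "holomorphic3_on (\<lambda>u. F u * G u) W"
proof (rule holomorphic3_onI)
  show "((\<lambda>u. F u * G u) has_derivative lin3 (cscale (F u) (grad3 G u) + cscale (G u) (grad3 F u))) (at u)"
    if "u \<in> W" for u
    using has_derivative_mult[OF assms[THEN holomorphic3_onD, OF that]]
    by (simp add: lin3_add[abs_def] lin3_cscale[abs_def] mult.commute)
qed (rule holomorphic3_on_imp_open[OF assms(1)])

lemma holomorphic3_on_compose:
  assumes "holomorphic3_on F W" "h holomorphic_on X" "open X" "F ` W \<subseteq> X"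
  shows "holomorphic3_on (\<lambda>u. h (F u)) W"
proof (rule holomorphic3_onI)
  show "((\<lambda>u. h (F u)) has_derivative lin3 (cscale (deriv h (F u)) (grad3 F u))) (at u)" if "u \<in> W" for u
  proof -
    have "(h has_derivative (*) (deriv h (F u))) (at (F u))"
      using holomorphic_derivI[OF assms(2,3)] assms(4) that by (auto simp: has_field_derivative_def)
    from has_derivative_compose[OF holomorphic3_onD[OF assms(1) that] this] show ?thesis
      by (simp add: lin3_cscale[abs_def])
  qed
qed (rule holomorphic3_on_imp_open[OF assms(1)])

lemma holomorphic3_on_coordinates:
  assumes "open W"
  shows "holomorphic3_on fst W" "holomorphic3_on (\<lambda>u. fst (snd u)) W" "holomorphic3_on (\<lambda>u. snd (snd u)) W"
proof -
  have "(fst has_derivative lin3 (1, 0, 0)) (at u)" "((\<lambda>u. fst (snd u)) has_derivative lin3 (0, 1, 0)) (at u)"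
    "((\<lambda>u. snd (snd u)) has_derivative lin3 (0, 0, 1)) (at u)" for u
    by (auto simp: lin3_alt case_prod_beta intro!: derivative_eq_intros)
  then show "holomorphic3_on fst W" "holomorphic3_on (\<lambda>u. fst (snd u)) W" "holomorphic3_on (\<lambda>u. snd (snd u)) W"
    by (auto intro!: holomorphic3_onI assms)
qed

lemma holomorphic3_on_poly:
  "open W \<Longrightarrow> holomorphic3_on (\<lambda>u. poly P (snd (snd u))) W"
  by (rule holomorphic3_on_compose[OF holomorphic3_on_coordinates(3), of _ _ UNIV])
    (auto intro!: holomorphic_intros)

lemma holomorphic3_on_minus: "holomorphic3_on F W \<Longrightarrow> holomorphic3_on (\<lambda>u. - F u) W"
  by (rule holomorphic3_on_compose[of _ _ _ UNIV]) (auto intro!: holomorphic_intros)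

lemma holomorphic3_on_swap:
  assumes "holomorphic3_on F W"
  shows "holomorphic3_on (\<lambda>u. F (swap_ts u)) (swap_ts -` W)"
proof (rule holomorphic3_onI)
  have swap: "swap_ts = (\<lambda>u. (fst (snd u), fst u, snd (snd u)))"
    by (auto simp: swap_ts_def)
  show "open (swap_ts -` W)"
    by (intro open_vimage holomorphic3_on_imp_open[OF assms]) (auto simp: swap intro!: continuous_intros)
  show "((\<lambda>u. F (swap_ts u)) has_derivative lin3 (swap_ts (grad3 F (swap_ts u)))) (at u)"
    if "u \<in> swap_ts -` W" for u
  proof -
    have "(swap_ts has_derivative swap_ts) (at u)"
      unfolding swap by (auto intro!: derivative_eq_intros)
    moreover have "lin3 g (swap_ts h) = lin3 (swap_ts g) h" for g h
      by (cases g; cases h) (simp add: swap_ts_def algebra_simps)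
    ultimately show ?thesis
      using has_derivative_compose[of swap_ts swap_ts u UNIV F, OF _ holomorphic3_onD[OF assms, of "swap_ts u"]] that
      by simp
  qed
qed

section \<open>Local representatives on a covering\<close>

text \<open>Constant loops are loops, so those at a and b are freely homotopic, and the homotopy
  traces a path from a to b.\<close>

lemma simply_connected_imp_connected_topological:
  assumes "simply_connected S"
  shows "connected S"
proof -
  have "path_component S a b" if "a \<in> S" "b \<in> S" for a b
  proof -
    have "homotopic_loops S (\<lambda>_. a) (\<lambda>_. b)"
      by (rule assms[unfolded simply_connected_def, rule_format])
        (use that in \<open>simp_all add: path_def path_image_def pathstart_def pathfinish_def image_subset_iff\<close>)
    then show ?thesis
      using homotopic_loops_imp_path_component_value[of S "\<lambda>_. a" "\<lambda>_. b" 0] by simp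
  qed
  then have "path_connected S"
    unfolding path_connected_component by blast
  then show ?thesis
    by (rule path_connected_imp_connected)
qed

text \<open>Coverings are open maps. Stated with an ambient open set so that it can be intersected
  with the domains of representatives.\<close>

lemma covering_space_image_neighbourhood:
  assumes "covering_space c p S" "openin (top_of_set c) V" "x \<in> V"
  obtains O' where "open O'" "p x \<in> O'" "S \<inter> O' \<subseteq> p ` V"
proof -
  have "x \<in> c"
    using assms(2,3) openin_imp_subset by blast
  then obtain T U q where T: "x \<in> T" "openin (top_of_set c) T" "p x \<in> U" "openin (top_of_set S) U"
    "homeomorphism T U p q"
    by (rule covering_space_local_homeomorphism[OF assms(1)]) (rule that)
  have "openin (top_of_set T) (T \<inter> V)"
    using openin_Int[OF T(2) assms(2)] openin_imp_subset[OF T(2)] by (blast intro: openin_subset_trans)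
  then have "openin (top_of_set U) (p ` (T \<inter> V))"
    using homeomorphism_imp_open_map[OF T(5)] by blast
  then have "openin (top_of_set S) (p ` (T \<inter> V))"
    using T(4) openin_trans by blast
  then obtain O' where "open O'" "p ` (T \<inter> V) = S \<inter> O'"
    by (auto simp: openin_open)
  with that[of O'] T(1) assms(3) show ?thesis
    by blast
qed

lemma local_rep_value: "local_rep hol M p f x F \<Longrightarrow> f x = F (p x)"
  by (auto simp: local_rep_def)

lemma local_rep_mem: "local_rep hol M p f x F \<Longrightarrow> x \<in> M"
  unfolding local_rep_def by (blast dest: openin_imp_subset)

text \<open>Every point of S near p x is hit by the common neighbourhood of x, where both
  representatives equal f. Off S they may differ, so derivatives transversal to S are not
  determined.\<close>

lemma local_reps_agree:
  assumes "covering_space M p S" "local_rep hol M p f x F" "local_rep hol M p f x F'"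
  obtains O' where "open O'" "p x \<in> O'" "\<And>u. u \<in> S \<inter> O' \<Longrightarrow> F u = F' u"
proof -
  obtain V where V: "openin (top_of_set M) V" "x \<in> V" "\<forall>y\<in>V. f y = F (p y)"
    using assms(2) unfolding local_rep_def by blast
  obtain V' where V': "openin (top_of_set M) V'" "x \<in> V'" "\<forall>y\<in>V'. f y = F' (p y)"
    using assms(3) unfolding local_rep_def by blast
  obtain O' where O': "open O'" "p x \<in> O'" "S \<inter> O' \<subseteq> p ` (V \<inter> V')"
    by (rule covering_space_image_neighbourhood[OF assms(1), of "V \<inter> V'" x]) (use V V' in auto)
  have "F u = F' u" if "u \<in> S \<inter> O'" for u
  proof -
    obtain y where "y \<in> V \<inter> V'" "u = p y"
      using O' \<open>u \<in> S \<inter> O'\<close> by blast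
    with V(3) V'(3) show ?thesis
      by (metis IntD1 IntD2)
  qed
  with O' that show ?thesis
    by blast
qed

lemma induced_op_eq:
  assumes "local_rep hol M p f x F"
    and "\<And>F'. local_rep hol M p f x F' \<Longrightarrow> D F' (p x) = D F (p x)"
  shows "induced_op hol M p D f x = D F (p x)"
proof -
  have "(THE c. \<exists>F. local_rep hol M p f x F \<and> c = D F (p x)) = D F (p x)"
    using assms by (intro the_equality) blast+
  then show ?thesis
    using local_rep_mem[OF assms(1)] by (simp add: induced_op_def)
qed

lemma universal_cover_image_mem:
  assumes "universal_cover \<Omega> p S" "x \<in> \<Omega>"
  shows "p x \<in> S"
  using assms by (auto simp: universal_cover_def covering_space_def)

lemma local_rep_holomorphic3D:
  assumes "local_rep holomorphic3_on M p f x F"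
  shows "(F has_derivative lin3 (grad3 F (p x))) (at (p x))"
proof -
  obtain V W where "x \<in> V" "p ` V \<subseteq> W" "holomorphic3_on F W"
    using assms unfolding local_rep_def by blast
  then show ?thesis
    by (auto simp: holomorphic3_on_iff)
qed

text \<open>
  Differentiating along \<open>v \<mapsto> (v, \<sigma>(z)/v, z)\<close> and \<open>v \<mapsto> (t, \<sigma>(v)/t, v)\<close>, which stay on
  the surface, shows that two derivatives of a representative are determined by the function.
\<close>
lemma local_reps_tangential:
  assumes cov: "universal_cover \<Omega> p (base_surface \<sigma>)"
    and F: "local_rep holomorphic3_on \<Omega> p f x F"
    and F': "local_rep holomorphic3_on \<Omega> p f x F'"
    and px: "p x = (t, s, z)"
  shows "F (t, s, z) = F' (t, s, z)"
    and "d_t F (t, s, z) - s / t * d_s F (t, s, z) = d_t F' (t, s, z) - s / t * d_s F' (t, s, z)"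
    and "d_z F (t, s, z) + poly (pderiv \<sigma>) z / t * d_s F (t, s, z) =
      d_z F' (t, s, z) + poly (pderiv \<sigma>) z / t * d_s F' (t, s, z)"
proof -
  have "(t, s, z) \<in> base_surface \<sigma>"
    using universal_cover_image_mem[OF cov local_rep_mem[OF F]] px by simp
  then have ts: "t \<noteq> 0" "s \<noteq> 0" "poly \<sigma> z = t * s"
    by (auto simp: base_surface_def)
  show "F (t, s, z) = F' (t, s, z)"
    using local_rep_value[OF F] local_rep_value[OF F'] px by simp
  obtain O' where O': "open O'" "(t, s, z) \<in> O'"
    and eq: "\<And>u. u \<in> base_surface \<sigma> \<inter> O' \<Longrightarrow> F u = F' u"
    using local_reps_agree[OF _ F F', of "base_surface \<sigma>"] cov
    unfolding universal_cover_def px by blast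
  \<comment> \<open>Both representatives coincide along a curve that stays on the surface near v0,
    hence so do their derivatives in the direction of its velocity e.\<close>
  have along: "lin3 (grad3 F (t, s, z)) e = lin3 (grad3 F' (t, s, z)) e"
    if \<gamma>: "(\<gamma> has_derivative (\<lambda>v. cscale v e)) (at v0)" "\<gamma> v0 = (t, s, z)"
      and on: "eventually (\<lambda>v. \<gamma> v \<in> base_surface \<sigma>) (nhds v0)" for \<gamma> v0 e
  proof -
    have "eventually (\<lambda>v. \<gamma> v \<in> O') (at v0)"
      using has_derivative_continuous[OF \<gamma>(1)] O' \<gamma>(2) by (simp add: isCont_def topological_tendstoD)
    then have "eventually (\<lambda>v. \<gamma> v \<in> O') (nhds v0)"
      using O' \<gamma>(2) by (simp add: eventually_nhds_conv_at)
    then have ev: "eventually (\<lambda>v. F (\<gamma> v) = F' (\<gamma> v)) (nhds v0)"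
      using on by eventually_elim (simp add: eq)
    have d: "(F has_derivative lin3 (grad3 F (t, s, z))) (at (\<gamma> v0))"
      "(F' has_derivative lin3 (grad3 F' (t, s, z))) (at (\<gamma> v0))"
      using local_rep_holomorphic3D[OF F] local_rep_holomorphic3D[OF F'] by (simp_all add: \<gamma>(2) px)
    have der: "((\<lambda>v. F (\<gamma> v)) has_field_derivative lin3 (grad3 F (t, s, z)) e) (at v0)"
      "((\<lambda>v. F' (\<gamma> v)) has_field_derivative lin3 (grad3 F' (t, s, z)) e) (at v0)"
      by (rule has_field_derivative_along[OF _ \<gamma>(1)], rule d)+
    show ?thesis
      by (rule DERIV_unique[OF iffD1[OF DERIV_cong_ev[OF refl ev refl] der(1)] der(2)])
  qed
  have "lin3 (grad3 F (t, s, z)) (1, - (s / t), 0) = lin3 (grad3 F' (t, s, z)) (1, - (s / t), 0)"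
  proof (rule along)
    \<comment> \<open>At v = t the derivative of \<sigma>(z)/v is -\<sigma>(z)/t^2 = -s/t, because
      \<sigma>(z) = ts.\<close>
    show "((\<lambda>v. (v, poly \<sigma> z / v, z)) has_derivative (\<lambda>v. cscale v (1, - (s / t), 0))) (at t)"
      using ts by (auto intro!: derivative_eq_intros simp: zero_prod_def fun_eq_iff)
    show "eventually (\<lambda>v. (v, poly \<sigma> z / v, z) \<in> base_surface \<sigma>) (nhds t)"
      using t1_space_nhds[OF ts(1)] by eventually_elim (use ts in \<open>simp add: base_surface_def\<close>)
  qed (use ts in auto)
  then show "d_t F (t, s, z) - s / t * d_s F (t, s, z) = d_t F' (t, s, z) - s / t * d_s F' (t, s, z)"
    by (simp add: grad3_def mult.commute)
  have "lin3 (grad3 F (t, s, z)) (0, poly (pderiv \<sigma>) z / t, 1) =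
      lin3 (grad3 F' (t, s, z)) (0, poly (pderiv \<sigma>) z / t, 1)"
  proof (rule along)
    show "((\<lambda>v. (t, poly \<sigma> v / t, v)) has_derivative (\<lambda>v. cscale v (0, poly (pderiv \<sigma>) z / t, 1))) (at z)"
      using ts poly_DERIV[of \<sigma> z, unfolded has_field_derivative_def]
      by (auto intro!: derivative_eq_intros simp: fun_eq_iff)
    \<comment> \<open>The second coordinate \<sigma>(v)/t must not vanish near z.\<close>
    have "open {v. poly \<sigma> v \<noteq> 0}"
      by (intro open_Collect_neq continuous_intros)
    with ts have "eventually (\<lambda>v. poly \<sigma> v \<noteq> 0) (nhds z)"
      using eventually_nhds_in_open[of "{v. poly \<sigma> v \<noteq> 0}" z] by simp
    then show "eventually (\<lambda>v. (t, poly \<sigma> v / t, v) \<in> base_surface \<sigma>) (nhds z)"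
      by eventually_elim (use ts in \<open>simp add: base_surface_def\<close>)
  qed (use ts in auto)
  then show "d_z F (t, s, z) + poly (pderiv \<sigma>) z / t * d_s F (t, s, z) =
      d_z F' (t, s, z) + poly (pderiv \<sigma>) z / t * d_s F' (t, s, z)"
    by (simp add: grad3_def algebra_simps)
qed

lemma local_repI:
  assumes "openin (top_of_set M) V" "x \<in> V" "open W" "p ` V \<subseteq> W" "hol F W" "\<And>y. y \<in> V \<Longrightarrow> f y = F (p y)"
  shows "local_rep hol M p f x F"
  unfolding local_rep_def using assms by (intro exI[of _ V] exI[of _ W]) simp

lemma local_repE:
  assumes "local_rep hol M p f x F"
  obtains V W where "openin (top_of_set M) V" "x \<in> V" "open W" "p ` V \<subseteq> W" "hol F W"
    "\<And>y. y \<in> V \<Longrightarrow> f y = F (p y)"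
  using assms unfolding local_rep_def by blast

lemma analytic_funs_extensional: "f \<in> analytic_funs hol M p \<Longrightarrow> f \<in> extensional M"
  by (simp add: analytic_funs_def)

lemma analytic_funs_repE:
  assumes "f \<in> analytic_funs hol M p" "x \<in> M"
  obtains F where "local_rep hol M p f x F"
  using assms by (auto simp: analytic_funs_def)

text \<open>Only representatives on open sets inside \<open>E\<close> matter; \<open>E\<close> excludes the pole \<open>t = 0\<close>.\<close>
lemma induced_op_in_space_A:
  assumes f: "f \<in> space_A M p" and E: "open E" "p ` M \<subseteq> E"
    and D: "\<And>F W. holomorphic3_on F W \<Longrightarrow> W \<subseteq> E \<Longrightarrow> holomorphic3_on (D F) W"
    and eq: "\<And>x F. local_rep holomorphic3_on M p f x F \<Longrightarrow>
      induced_op holomorphic3_on M p D f x = D F (p x)"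
  shows "induced_op holomorphic3_on M p D f \<in> space_A M p"
proof -
  have "\<exists>G. local_rep holomorphic3_on M p (induced_op holomorphic3_on M p D f) x G" if x: "x \<in> M" for x
  proof -
    obtain F where rep: "local_rep holomorphic3_on M p f x F"
      using f x by (rule analytic_funs_repE)
    obtain V W where F: "openin (top_of_set M) V" "x \<in> V" "open W" "p ` V \<subseteq> W"
      "holomorphic3_on F W" "\<And>y. y \<in> V \<Longrightarrow> f y = F (p y)"
      using rep by (rule local_repE) (rule that)
    \<comment> \<open>F represents f at every point of V, not only at x; hence D F represents the
      image on all of V.\<close>
    have "induced_op holomorphic3_on M p D f y = D F (p y)" if "y \<in> V" for y
      using F(1) that F(3-6) by (intro eq local_repI[of M V y W])
    moreover have "p ` V \<subseteq> W \<inter> E"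
      using F(1,4) E(2) openin_imp_subset by blast
    moreover have "holomorphic3_on (D F) (W \<inter> E)"
      using F E by (intro D holomorphic3_on_subset[OF F(5)]) auto
    ultimately have "local_rep holomorphic3_on M p (induced_op holomorphic3_on M p D f) x (D F)"
      using F(1-3) E(1) by (intro local_repI[of M V x "W \<inter> E"]) auto
    then show ?thesis
      by (rule exI[of _ "D F"])
  qed
  moreover have "induced_op holomorphic3_on M p D f \<in> extensional M"
    unfolding induced_op_def by (rule restrict_extensional)
  ultimately show ?thesis
    by (simp add: analytic_funs_def)
qed

section \<open>The operators on the surface\<close>

locale surface_cover =
  fixes \<sigma> :: "complex poly" and \<Omega> :: "'a::topological_space set"
    and p :: "'a \<Rightarrow> complex \<times> complex \<times> complex"
  assumes cover: "universal_cover \<Omega> p (base_surface \<sigma>)"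
begin

lemma base_point:
  assumes "x \<in> \<Omega>" "p x = (t, s, z)"
  shows "t \<noteq> 0" "s \<noteq> 0" "poly \<sigma> z = t * s"
  using universal_cover_image_mem[OF cover assms(1)] assms(2) by (auto simp: base_surface_def)

text \<open>N is t times the first tangential derivative of \<open>local_reps_tangential\<close>, so
  any representative computes it.\<close>

lemma op_N_rep:
  assumes F: "local_rep holomorphic3_on \<Omega> p f x F" and px: "p x = (t, s, z)"
  shows "op_N \<Omega> p f x = t * d_t F (t, s, z) - s * d_s F (t, s, z)"
proof -
  have t: "t \<noteq> 0"
    using base_point(1)[OF local_rep_mem[OF F] px] .
  have *: "t * d_t F' (t, s, z) - s * d_s F' (t, s, z) = t * (d_t F' (t, s, z) - s / t * d_s F' (t, s, z))" for F'
    using t by (simp add: field_simps)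
  show ?thesis
    unfolding op_N_def
    by (subst induced_op_eq[OF F])
      (use local_reps_tangential(2)[OF cover _ F px] in \<open>simp_all add: px *\<close>)
qed

lemma op_A_plus_rep:
  assumes F: "local_rep holomorphic3_on \<Omega> p f x F" and px: "p x = (t, s, z)"
  shows "op_A_plus \<sigma> \<Omega> p f x = t * d_z F (t, s, z) + poly (pderiv \<sigma>) z * d_s F (t, s, z)"
proof -
  have t: "t \<noteq> 0"
    using base_point(1)[OF local_rep_mem[OF F] px] .
  have *: "t * d_z F' (t, s, z) + poly (pderiv \<sigma>) z * d_s F' (t, s, z) =
      t * (d_z F' (t, s, z) + poly (pderiv \<sigma>) z / t * d_s F' (t, s, z))" for F'
    using t by (simp add: field_simps)
  show ?thesis
    unfolding op_A_plus_def
    by (subst induced_op_eq[OF F])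
      (use local_reps_tangential(3)[OF cover _ F px] in \<open>simp_all add: px *\<close>)
qed

lemma op_A_minus_rep:
  assumes F: "local_rep holomorphic3_on \<Omega> p f x F" and px: "p x = (t, s, z)"
  shows "op_A_minus \<sigma> \<kappa> \<Omega> p f x = s * d_z F (t, s, z) + poly (pderiv \<sigma>) z * d_t F (t, s, z)
    + poly \<kappa> z / t * F (t, s, z)"
proof -
  have t: "t \<noteq> 0"
    using base_point(1)[OF local_rep_mem[OF F] px] .
  \<comment> \<open>The \<partial>_s terms of the two tangential derivatives cancel in this
    combination.\<close>
  have *: "s * d_z F' (t, s, z) + poly (pderiv \<sigma>) z * d_t F' (t, s, z) =
      s * (d_z F' (t, s, z) + poly (pderiv \<sigma>) z / t * d_s F' (t, s, z))
      + poly (pderiv \<sigma>) z * (d_t F' (t, s, z) - s / t * d_s F' (t, s, z))" for F'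
    using t by (simp add: field_simps)
  show ?thesis
    unfolding op_A_minus_def
    by (subst induced_op_eq[OF F])
      (use local_reps_tangential[OF cover _ F px] in \<open>simp_all add: px *\<close>)
qed

lemma open_fst_nonzero: "open {u :: complex \<times> complex \<times> complex. fst u \<noteq> 0}" "p ` \<Omega> \<subseteq> {u. fst u \<noteq> 0}"
proof -
  show "open {u :: complex \<times> complex \<times> complex. fst u \<noteq> 0}"
    by (intro open_Collect_neq continuous_intros)
  show "p ` \<Omega> \<subseteq> {u. fst u \<noteq> 0}"
    using base_point(1) by (metis (mono_tags) image_subsetI mem_Collect_eq prod.collapse)
qed

lemma op_N_in_space_A:
  assumes "f \<in> space_A \<Omega> p"
  shows "op_N \<Omega> p f \<in> space_A \<Omega> p"
  unfolding op_N_def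
proof (rule induced_op_in_space_A[OF assms open_fst_nonzero])
  fix F W assume F: "holomorphic3_on F W"
  have "holomorphic3_on (\<lambda>u. fst u * d_t F u + - (fst (snd u) * d_s F u)) W"
    by (intro holomorphic3_on_add holomorphic3_on_mult holomorphic3_on_minus holomorphic3_on_partials
        holomorphic3_on_coordinates F holomorphic3_on_imp_open[OF F])
  then show "holomorphic3_on (\<lambda>(t, s, z). t * d_t F (t, s, z) - s * d_s F (t, s, z)) W"
    by (simp add: case_prod_unfold)
next
  fix x F assume F: "local_rep holomorphic3_on \<Omega> p f x F"
  obtain t s z where px: "p x = (t, s, z)"
    by (cases "p x") auto
  show "induced_op holomorphic3_on \<Omega> p (\<lambda>F (t, s, z). t * d_t F (t, s, z) - s * d_s F (t, s, z)) f x =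
      (\<lambda>(t, s, z). t * d_t F (t, s, z) - s * d_s F (t, s, z)) (p x)"
    using op_N_rep[OF F px] by (simp add: px op_N_def)
qed

lemma op_A_plus_in_space_A:
  assumes "f \<in> space_A \<Omega> p"
  shows "op_A_plus \<sigma> \<Omega> p f \<in> space_A \<Omega> p"
  unfolding op_A_plus_def
proof (rule induced_op_in_space_A[OF assms open_fst_nonzero])
  fix F W assume F: "holomorphic3_on F W"
  have "holomorphic3_on (\<lambda>u. fst u * d_z F u + poly (pderiv \<sigma>) (snd (snd u)) * d_s F u) W"
    by (intro holomorphic3_on_add holomorphic3_on_mult holomorphic3_on_poly holomorphic3_on_partials
        holomorphic3_on_coordinates F holomorphic3_on_imp_open[OF F])
  then show "holomorphic3_on (\<lambda>(t, s, z). t * d_z F (t, s, z) + poly (pderiv \<sigma>) z * d_s F (t, s, z)) W"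
    by (simp add: case_prod_unfold)
next
  fix x F assume F: "local_rep holomorphic3_on \<Omega> p f x F"
  obtain t s z where px: "p x = (t, s, z)"
    by (cases "p x") auto
  show "induced_op holomorphic3_on \<Omega> p
        (\<lambda>F (t, s, z). t * d_z F (t, s, z) + poly (pderiv \<sigma>) z * d_s F (t, s, z)) f x =
      (\<lambda>(t, s, z). t * d_z F (t, s, z) + poly (pderiv \<sigma>) z * d_s F (t, s, z)) (p x)"
    using op_A_plus_rep[OF F px] by (simp add: px op_A_plus_def)
qed

lemma op_A_minus_in_space_A:
  assumes "f \<in> space_A \<Omega> p"
  shows "op_A_minus \<sigma> \<kappa> \<Omega> p f \<in> space_A \<Omega> p"
  unfolding op_A_minus_def
proof (rule induced_op_in_space_A[OF assms open_fst_nonzero])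
  fix F W assume F: "holomorphic3_on F W" and W: "W \<subseteq> {u. fst u \<noteq> 0}"
  have inv: "holomorphic3_on (\<lambda>u. inverse (fst u)) W"
    by (rule holomorphic3_on_compose[OF holomorphic3_on_coordinates(1), of _ _ "- {0}"])
      (use W holomorphic3_on_imp_open[OF F] in \<open>auto intro!: holomorphic_intros\<close>)
  have "holomorphic3_on (\<lambda>u. fst (snd u) * d_z F u + poly (pderiv \<sigma>) (snd (snd u)) * d_t F u
      + poly \<kappa> (snd (snd u)) * inverse (fst u) * F u) W"
    by (intro holomorphic3_on_add holomorphic3_on_mult holomorphic3_on_poly holomorphic3_on_partials
        holomorphic3_on_coordinates F inv holomorphic3_on_imp_open[OF F])
  then show "holomorphic3_on (\<lambda>(t, s, z). s * d_z F (t, s, z) + poly (pderiv \<sigma>) z * d_t F (t, s, z)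
      + poly \<kappa> z / t * F (t, s, z)) W"
    by (simp add: case_prod_unfold divide_inverse)
next
  fix x F assume F: "local_rep holomorphic3_on \<Omega> p f x F"
  obtain t s z where px: "p x = (t, s, z)"
    by (cases "p x") auto
  show "induced_op holomorphic3_on \<Omega> p
        (\<lambda>F (t, s, z). s * d_z F (t, s, z) + poly (pderiv \<sigma>) z * d_t F (t, s, z)
          + poly \<kappa> z / t * F (t, s, z)) f x =
      (\<lambda>(t, s, z). s * d_z F (t, s, z) + poly (pderiv \<sigma>) z * d_t F (t, s, z)
          + poly \<kappa> z / t * F (t, s, z)) (p x)"
    using op_A_minus_rep[OF F px] by (simp add: px op_A_minus_def)
qed

text \<open>Needed to pull a sign out of the outer N in N^2. Linearity is not built into a definite
  description, so the negated representative is exhibited.\<close>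

lemma op_N_uminus:
  assumes f: "f \<in> space_A \<Omega> p"
  shows "op_N \<Omega> p (\<lambda>x\<in>\<Omega>. - f x) = (\<lambda>x\<in>\<Omega>. - op_N \<Omega> p f x)"
proof (rule extensionalityI[of _ \<Omega>])
  fix x assume x: "x \<in> \<Omega>"
  obtain F where rep: "local_rep holomorphic3_on \<Omega> p f x F"
    using f x by (rule analytic_funs_repE)
  obtain V W where F: "openin (top_of_set \<Omega>) V" "x \<in> V" "open W" "p ` V \<subseteq> W"
    "holomorphic3_on F W" "\<And>y. y \<in> V \<Longrightarrow> f y = F (p y)"
    using rep by (rule local_repE) (rule that)
  have "(\<lambda>x\<in>\<Omega>. - f x) y = - F (p y)" if "y \<in> V" for y
    using F(6)[OF that] openin_imp_subset[OF F(1)] that by auto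
  then have rep': "local_rep holomorphic3_on \<Omega> p (\<lambda>x\<in>\<Omega>. - f x) x (\<lambda>u. - F u)"
    using F(1-4) holomorphic3_on_minus[OF F(5)] by (intro local_repI[of \<Omega> V x W])
  have "((\<lambda>u. - F u) has_derivative lin3 (- grad3 F (p x))) (at (p x))"
    using has_derivative_minus[OF local_rep_holomorphic3D[OF rep]]
    by (simp add: lin3_uminus[abs_def])
  then have g: "grad3 (\<lambda>u. - F u) (p x) = - grad3 F (p x)"
    by (rule grad3_eq)
  obtain t s z where px: "p x = (t, s, z)"
    by (cases "p x") auto
  show "op_N \<Omega> p (\<lambda>x\<in>\<Omega>. - f x) x = (\<lambda>x\<in>\<Omega>. - op_N \<Omega> p f x) x"
    using g x by (simp add: op_N_rep[OF rep px] op_N_rep[OF rep' px] grad3_def px)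
qed (simp_all add: op_N_def induced_op_def)

end

section \<open>Zeros of the twisting function\<close>

text \<open>Since S is open, representatives agree on a full neighbourhood, and the whole derivative
  is determined.\<close>

lemma dz_\<Theta>_rep:
  assumes cov: "universal_cover \<Theta> q S" and "open S"
    and R: "local_rep (\<lambda>f W. f holomorphic_on W) \<Theta> q \<rho> \<theta> R"
  shows "dz_\<Theta> \<Theta> q \<rho> \<theta> = deriv R (q \<theta>)"
  unfolding dz_\<Theta>_def
proof (rule induced_op_eq[OF R])
  fix R' assume R': "local_rep (\<lambda>f W. f holomorphic_on W) \<Theta> q \<rho> \<theta> R'"
  have "covering_space \<Theta> q S"
    using cov by (simp add: universal_cover_def)
  then obtain O' where O': "open O'" "q \<theta> \<in> O'" "\<And>u. u \<in> S \<inter> O' \<Longrightarrow> R' u = R u"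
    by (rule local_reps_agree[OF _ R' R]) (rule that)
  have "q \<theta> \<in> S"
    by (rule universal_cover_image_mem[OF cov local_rep_mem[OF R]])
  then have "eventually (\<lambda>u. u \<in> S \<inter> O') (nhds (q \<theta>))"
    using O' assms(2) by (intro eventually_nhds_in_open) auto
  then have "eventually (\<lambda>u. R' u = R u) (nhds (q \<theta>))"
    by eventually_elim (rule O'(3))
  then show "deriv R' (q \<theta>) = deriv R (q \<theta>)"
    by (rule deriv_cong_ev) simp
qed

text \<open>
  Dividing a solution of \<open>R' = m R\<close> by the exponential of a primitive of \<open>m\<close> gives a constant.
\<close>
lemma linear_ode_zero_iff:
  assumes R: "R holomorphic_on ball c e" and m: "m holomorphic_on ball c e"
    and ode: "\<And>u. u \<in> ball c e \<Longrightarrow> deriv R u = m u * R u"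
    and u: "u \<in> ball c e" "v \<in> ball c e"
  shows "R u = 0 \<longleftrightarrow> R v = 0"
proof -
  obtain g where g': "\<And>x. x \<in> ball c e \<Longrightarrow> (g has_field_derivative m x) (at x within ball c e)"
    using holomorphic_convex_primitive'[OF convex_ball open_ball m] by metis
  have g: "(g has_field_derivative m x) (at x)" if "x \<in> ball c e" for x
    using g'[OF that] unfolding at_within_open[OF that open_ball] .
  have "((\<lambda>x. R x * exp (- g x)) has_field_derivative 0) (at x)" if x: "x \<in> ball c e" for x
  proof -
    have "((\<lambda>x. R x * exp (- g x)) has_field_derivative
        deriv R x * exp (- g x) + exp (- g x) * (- m x) * R x) (at x)"
      by (rule DERIV_mult[OF holomorphic_derivI[OF R open_ball x] DERIV_fun_exp[OF DERIV_minus[OF g[OF x]]]])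
    then show ?thesis
      by (simp add: ode[OF x])
  qed
  then have "(\<lambda>x. R x * exp (- g x)) constant_on ball c e"
    by (rule has_field_derivative_0_imp_constant_on) auto
  then have "R u * exp (- g u) = R v * exp (- g v)"
    using u unfolding constant_on_def by metis
  then show ?thesis
    by auto
qed

text \<open>Off the zeros of \<sigma> the equation reads \<rho>' = (\<kappa>/\<sigma>) \<rho>. Local
  uniqueness makes the truth value of \<rho> = 0 locally constant, and \<Theta> is
  connected.\<close>

lemma linear_ode_solution_nonzero:
  assumes cov: "universal_cover \<Theta> q (UNIV - {z. poly \<sigma> z = 0})"
    and \<rho>: "\<rho> \<in> space_A\<Theta> \<Theta> q" and nz: "\<exists>\<theta>\<in>\<Theta>. \<rho> \<theta> \<noteq> 0"
    and ode: "\<forall>\<theta>\<in>\<Theta>. poly \<sigma> (q \<theta>) * dz_\<Theta> \<Theta> q \<rho> \<theta> - poly \<kappa> (q \<theta>) * \<rho> \<theta> = 0"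
    and "\<theta> \<in> \<Theta>"
  shows "\<rho> \<theta> \<noteq> 0"
proof -
  let ?S = "UNIV - {z. poly \<sigma> z = 0}"
  have S: "?S = {z. poly \<sigma> z \<noteq> 0}"
    by blast
  have opS: "open ?S"
    unfolding S by (intro open_Collect_neq continuous_intros)
  have cs: "covering_space \<Theta> q ?S" and sc: "simply_connected \<Theta>"
    using cov unfolding universal_cover_def by blast+
  have "\<exists>T. openin (top_of_set \<Theta>) T \<and> a \<in> T \<and> (\<forall>y\<in>T. (\<rho> y = 0) = (\<rho> a = 0))" if a: "a \<in> \<Theta>" for a
  proof -
    obtain R where rep: "local_rep (\<lambda>f W. f holomorphic_on W) \<Theta> q \<rho> a R"
      using \<rho> a by (rule analytic_funs_repE)
    obtain V W where R: "openin (top_of_set \<Theta>) V" "a \<in> V" "open W" "q ` V \<subseteq> W"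
      "R holomorphic_on W" "\<And>y. y \<in> V \<Longrightarrow> \<rho> y = R (q y)"
      using rep by (rule local_repE) (rule that)
    obtain O' where O': "open O'" "q a \<in> O'" "?S \<inter> O' \<subseteq> q ` V"
      using cs R(1,2) by (rule covering_space_image_neighbourhood) (rule that)
    have qS: "q y \<in> ?S" if "y \<in> \<Theta>" for y
      by (rule universal_cover_image_mem[OF cov that])
    have "open (W \<inter> (?S \<inter> O'))" "q a \<in> W \<inter> (?S \<inter> O')"
      using R(2-4) O'(1,2) opS qS[OF a] by (blast intro: open_Int)+
    then obtain e where e: "e > 0" "ball (q a) e \<subseteq> W \<inter> (?S \<inter> O')"
      unfolding open_contains_ball by blast
    have eW: "ball (q a) e \<subseteq> W" and eS: "ball (q a) e \<subseteq> {z. poly \<sigma> z \<noteq> 0}"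
      using e(2) S by blast+
    \<comment> \<open>Each u in the ball lifts to some y in V, and R also represents \<rho> at y;
      the equation on \<Theta> thus descends to R on the whole ball.\<close>
    have de: "deriv R u = poly \<kappa> u / poly \<sigma> u * R u" if u: "u \<in> ball (q a) e" for u
    proof -
      obtain y where y: "y \<in> V" "u = q y"
        using O'(3) e(2) u by blast
      then have y\<Theta>: "y \<in> \<Theta>"
        using R(1) openin_imp_subset by blast
      have "local_rep (\<lambda>f W. f holomorphic_on W) \<Theta> q \<rho> y R"
        using R(1) y(1) R(3-6) by (intro local_repI[of \<Theta> V y W])
      then have "dz_\<Theta> \<Theta> q \<rho> y = deriv R u"
        unfolding y(2) by (rule dz_\<Theta>_rep[OF cov opS])
      then have "poly \<sigma> u * deriv R u = poly \<kappa> u * R u"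
        using bspec[OF ode y\<Theta>] R(6)[OF y(1)] y(2) by simp
      moreover have "poly \<sigma> u \<noteq> 0"
        using eS u by blast
      ultimately show ?thesis
        by (simp add: nonzero_eq_divide_eq mult.commute)
    qed
    have R0: "R u = 0 \<longleftrightarrow> R (q a) = 0" if "u \<in> ball (q a) e" for u
    proof (rule linear_ode_zero_iff[of R "q a" e "\<lambda>u. poly \<kappa> u / poly \<sigma> u"])
      show "R holomorphic_on ball (q a) e"
        using R(5) eW by (rule holomorphic_on_subset)
      show "(\<lambda>u. poly \<kappa> u / poly \<sigma> u) holomorphic_on ball (q a) e"
        using eS by (intro holomorphic_intros) auto
      show "q a \<in> ball (q a) e"
        using e(1) by simp
    qed (use de that in blast)+
    have "openin (top_of_set \<Theta>) (V \<inter> (\<Theta> \<inter> q -` ball (q a) e))"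
      using R(1) covering_space_imp_continuous[OF cs]
      by (intro openin_Int continuous_openin_preimage_gen open_ball)
    moreover have "(\<rho> y = 0) = (\<rho> a = 0)" if "y \<in> V \<inter> (\<Theta> \<inter> q -` ball (q a) e)" for y
    proof -
      have "y \<in> V" "q y \<in> ball (q a) e"
        using that by blast+
      then show ?thesis
        unfolding R(6)[OF \<open>y \<in> V\<close>] R(6)[OF R(2)] by (intro R0)
    qed
    moreover have "a \<in> V \<inter> (\<Theta> \<inter> q -` ball (q a) e)"
      using R(2) a e(1) by simp
    ultimately show ?thesis
      by blast
  qed
  then have "(\<lambda>\<theta>. \<rho> \<theta> = 0) constant_on \<Theta>"
    by (rule locally_constant_imp_constant[OF simply_connected_imp_connected_topological[OF sc]])
  then show ?thesis
    using nz \<open>\<theta> \<in> \<Theta>\<close> unfolding constant_on_def by blast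
qed

section \<open>Intertwining\<close>

locale twisted_swap = surface_cover \<sigma> \<Omega> p
  for \<sigma> and \<Omega> :: "'a::topological_space set" and p +
  fixes \<Theta> :: "'b::topological_space set" and q :: "'b \<Rightarrow> complex"
    and \<zeta> :: "'a \<Rightarrow> 'b" and \<tau> :: "'a \<Rightarrow> 'a" and \<kappa> :: "complex poly" and \<rho> :: "'b \<Rightarrow> complex"
  assumes cover_\<Theta>: "universal_cover \<Theta> q (UNIV - {z. poly \<sigma> z = 0})"
    and \<zeta>_cont: "continuous_on \<Omega> \<zeta>" and \<zeta>_in: "x \<in> \<Omega> \<Longrightarrow> \<zeta> x \<in> \<Theta>"
    and q_\<zeta>: "x \<in> \<Omega> \<Longrightarrow> q (\<zeta> x) = coord_z (p x)"
    and \<tau>_cont: "continuous_on \<Omega> \<tau>" and \<tau>_in: "x \<in> \<Omega> \<Longrightarrow> \<tau> x \<in> \<Omega>"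
    and \<tau>_\<tau>: "x \<in> \<Omega> \<Longrightarrow> \<tau> (\<tau> x) = x" and p_\<tau>: "x \<in> \<Omega> \<Longrightarrow> p (\<tau> x) = swap_ts (p x)"
    and \<zeta>_\<tau>: "x \<in> \<Omega> \<Longrightarrow> \<zeta> (\<tau> x) = \<zeta> x"
    and \<rho>_in: "\<rho> \<in> space_A\<Theta> \<Theta> q" and \<rho>_nonzero: "\<theta> \<in> \<Theta> \<Longrightarrow> \<rho> \<theta> \<noteq> 0"
    and \<rho>_ode: "\<theta> \<in> \<Theta> \<Longrightarrow> poly \<sigma> (q \<theta>) * dz_\<Theta> \<Theta> q \<rho> \<theta> = poly \<kappa> (q \<theta>) * \<rho> \<theta>"
begin

section \<open>Invertibility of the transformation\<close>

text \<open>The multiplier \<mu> is arbitrary so that the result also serves 1/\<rho>, the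
  multiplier of the inverse.\<close>

lemma op_T_rep:
  assumes x: "x \<in> \<Omega>"
    and R: "local_rep (\<lambda>f W. f holomorphic_on W) \<Theta> q \<mu> (\<zeta> x) R"
    and F: "local_rep holomorphic3_on \<Omega> p f (\<tau> x) F"
  shows "local_rep holomorphic3_on \<Omega> p (op_T \<Omega> \<zeta> \<tau> \<mu> f) x (\<lambda>u. R (coord_z u) * F (swap_ts u))"
proof -
  obtain V W where R: "openin (top_of_set \<Theta>) V" "\<zeta> x \<in> V" "open W" "q ` V \<subseteq> W"
    "R holomorphic_on W" "\<And>y. y \<in> V \<Longrightarrow> \<mu> y = R (q y)"
    using R by (rule local_repE) (rule that)
  obtain V' W' where F: "openin (top_of_set \<Omega>) V'" "\<tau> x \<in> V'" "open W'" "p ` V' \<subseteq> W'"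
    "holomorphic3_on F W'" "\<And>y. y \<in> V' \<Longrightarrow> f y = F (p y)"
    using F by (rule local_repE) (rule that)
  let ?V = "(\<Omega> \<inter> \<zeta> -` V) \<inter> (\<Omega> \<inter> \<tau> -` V')"
  let ?Z = "{u :: complex \<times> complex \<times> complex. coord_z u \<in> W}"
  let ?W = "?Z \<inter> swap_ts -` W'"
  have F': "holomorphic3_on (\<lambda>u. F (swap_ts u)) (swap_ts -` W')"
    by (rule holomorphic3_on_swap[OF F(5)])
  have Z: "open ?Z"
    using open_vimage[OF R(3), of "\<lambda>u :: complex \<times> complex \<times> complex. coord_z u"]
    by (simp add: vimage_def continuous_intros)
  have W: "open ?W"
    using Z holomorphic3_on_imp_open[OF F'] by (rule open_Int)
  show ?thesis
  proof (rule local_repI[of \<Omega> ?V x ?W])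
    show "openin (top_of_set \<Omega>) ?V"
      using continuous_openin_preimage[OF \<zeta>_cont _ R(1)] continuous_openin_preimage[OF \<tau>_cont _ F(1)]
        \<zeta>_in \<tau>_in by (intro openin_Int[of _ "\<Omega> \<inter> \<zeta> -` V"]) auto
    show "x \<in> ?V" "open ?W"
      using x R(2) F(2) W by auto
    show "p ` ?V \<subseteq> ?W"
    proof (rule image_subsetI)
      fix y assume y: "y \<in> ?V"
      then have "coord_z (p y) = q (\<zeta> y)" "swap_ts (p y) = p (\<tau> y)"
        using q_\<zeta> p_\<tau> by auto
      then show "p y \<in> ?W"
        using y R(4) F(4) by auto
    qed
    have "holomorphic3_on (\<lambda>u. R (coord_z u)) ?W"
      using W by (intro holomorphic3_on_compose[OF holomorphic3_on_coordinates(3) R(5,3)]) auto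
    moreover have "holomorphic3_on (\<lambda>u. F (swap_ts u)) ?W"
      using F' W by (rule holomorphic3_on_subset) auto
    ultimately show "holomorphic3_on (\<lambda>u. R (coord_z u) * F (swap_ts u)) ?W"
      by (rule holomorphic3_on_mult)
    show "op_T \<Omega> \<zeta> \<tau> \<mu> f y = R (coord_z (p y)) * F (swap_ts (p y))" if "y \<in> ?V" for y
    proof -
      have y: "y \<in> \<Omega>" "\<zeta> y \<in> V" "\<tau> y \<in> V'"
        using that by auto
      show ?thesis
        using R(6)[OF y(2)] F(6)[OF y(3)] q_\<zeta>[OF y(1)] p_\<tau>[OF y(1)] y(1) by (simp add: op_T_def)
    qed
  qed
qed

lemma op_T_in_space_A:
  assumes \<mu>: "\<mu> \<in> space_A\<Theta> \<Theta> q" and f: "f \<in> space_A \<Omega> p"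
  shows "op_T \<Omega> \<zeta> \<tau> \<mu> f \<in> space_A \<Omega> p"
proof -
  have "\<exists>G. local_rep holomorphic3_on \<Omega> p (op_T \<Omega> \<zeta> \<tau> \<mu> f) x G" if x: "x \<in> \<Omega>" for x
  proof -
    obtain R where R: "local_rep (\<lambda>f W. f holomorphic_on W) \<Theta> q \<mu> (\<zeta> x) R"
      using \<mu> \<zeta>_in[OF x] by (rule analytic_funs_repE)
    obtain F where F: "local_rep holomorphic3_on \<Omega> p f (\<tau> x) F"
      using f \<tau>_in[OF x] by (rule analytic_funs_repE)
    show ?thesis
      by (rule exI, rule op_T_rep[OF x R F])
  qed
  moreover have "op_T \<Omega> \<zeta> \<tau> \<mu> f \<in> extensional \<Omega>"
    unfolding op_T_def by (rule restrict_extensional)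
  ultimately show ?thesis
    by (simp add: analytic_funs_def)
qed

lemma inverse_\<rho>_in: "(\<lambda>\<theta>\<in>\<Theta>. inverse (\<rho> \<theta>)) \<in> space_A\<Theta> \<Theta> q"
proof -
  have "\<exists>G. local_rep (\<lambda>f W. f holomorphic_on W) \<Theta> q (\<lambda>\<theta>\<in>\<Theta>. inverse (\<rho> \<theta>)) a G" if a: "a \<in> \<Theta>" for a
  proof -
    obtain R where rep: "local_rep (\<lambda>f W. f holomorphic_on W) \<Theta> q \<rho> a R"
      using \<rho>_in a by (rule analytic_funs_repE)
    obtain V W where R: "openin (top_of_set \<Theta>) V" "a \<in> V" "open W" "q ` V \<subseteq> W"
      "R holomorphic_on W" "\<And>y. y \<in> V \<Longrightarrow> \<rho> y = R (q y)"
      using rep by (rule local_repE) (rule that)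
    have V: "V \<subseteq> \<Theta>"
      using R(1) openin_imp_subset by blast
    \<comment> \<open>R may vanish on W away from the image of V; only on that image does it equal
      the zero-free \<rho>.\<close>
    let ?W = "W \<inter> R -` (- {0})"
    have "open ?W"
      using R(3,5) by (intro continuous_open_preimage holomorphic_on_imp_continuous_on) auto
    moreover have "q ` V \<subseteq> ?W"
    proof (rule image_subsetI)
      fix y assume y: "y \<in> V"
      then have "R (q y) \<noteq> 0"
        using R(6)[OF y] \<rho>_nonzero V by auto
      then show "q y \<in> ?W"
        using y R(4) by auto
    qed
    moreover have "(\<lambda>u. inverse (R u)) holomorphic_on ?W"
      by (intro holomorphic_intros holomorphic_on_subset[OF R(5)]) auto
    moreover have "(\<lambda>\<theta>\<in>\<Theta>. inverse (\<rho> \<theta>)) y = inverse (R (q y))" if "y \<in> V" for y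
      using R(6)[OF that] that V by auto
    ultimately have "local_rep (\<lambda>f W. f holomorphic_on W) \<Theta> q (\<lambda>\<theta>\<in>\<Theta>. inverse (\<rho> \<theta>)) a (\<lambda>u. inverse (R u))"
      using R(1,2) by (intro local_repI[of \<Theta> V a ?W])
    then show ?thesis
      by (rule exI[of _ "\<lambda>u. inverse (R u)"])
  qed
  then show ?thesis
    by (simp add: analytic_funs_def)
qed

text \<open>Because \<zeta> is invariant under \<tau>, both multipliers are evaluated at the same
  point of \<Theta>, and the two swaps cancel.\<close>

lemma op_T_op_T:
  assumes f: "f \<in> space_A \<Omega> p" and \<mu>\<nu>: "\<And>\<theta>. \<theta> \<in> \<Theta> \<Longrightarrow> \<mu> \<theta> * \<nu> \<theta> = 1"
  shows "op_T \<Omega> \<zeta> \<tau> \<mu> (op_T \<Omega> \<zeta> \<tau> \<nu> f) = f"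
proof (rule extensionalityI[of _ \<Omega>])
  show "f \<in> extensional \<Omega>"
    using f by (rule analytic_funs_extensional)
  fix x assume x: "x \<in> \<Omega>"
  have "\<mu> (\<zeta> x) * (\<nu> (\<zeta> x) * f x) = f x"
    using \<mu>\<nu>[OF \<zeta>_in[OF x]] by (simp flip: mult.assoc)
  then show "op_T \<Omega> \<zeta> \<tau> \<mu> (op_T \<Omega> \<zeta> \<tau> \<nu> f) x = f x"
    using x by (simp add: op_T_def \<tau>_in \<zeta>_\<tau> \<tau>_\<tau>)
qed (simp add: op_T_def)

lemma bij_betw_op_T: "bij_betw (op_T \<Omega> \<zeta> \<tau> \<rho>) (space_A \<Omega> p) (space_A \<Omega> p)"
proof (rule bij_betwI[of _ _ _ "op_T \<Omega> \<zeta> \<tau> (\<lambda>\<theta>\<in>\<Theta>. inverse (\<rho> \<theta>))"])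
  show "op_T \<Omega> \<zeta> \<tau> \<rho> \<in> space_A \<Omega> p \<rightarrow> space_A \<Omega> p"
    using op_T_in_space_A[OF \<rho>_in] by blast
  show "op_T \<Omega> \<zeta> \<tau> (\<lambda>\<theta>\<in>\<Theta>. inverse (\<rho> \<theta>)) \<in> space_A \<Omega> p \<rightarrow> space_A \<Omega> p"
    using op_T_in_space_A[OF inverse_\<rho>_in] by blast
qed (auto intro!: op_T_op_T simp: \<rho>_nonzero)

section \<open>Commutation with the operators\<close>

text \<open>The swap exchanges the t- and s-derivatives, and the multiplier depends on z alone, so
  only the z-derivative gains a term.\<close>

lemma op_T_derivatives:
  assumes x: "x \<in> \<Omega>" and px: "p x = (t, s, z)" and f: "f \<in> space_A \<Omega> p"
  obtains R F G where "local_rep holomorphic3_on \<Omega> p f (\<tau> x) F"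
    "local_rep holomorphic3_on \<Omega> p (op_T \<Omega> \<zeta> \<tau> \<rho> f) x G"
    "\<rho> (\<zeta> x) = R z" "poly \<sigma> z * deriv R z = poly \<kappa> z * R z"
    "G (t, s, z) = R z * F (s, t, z)"
    "d_t G (t, s, z) = R z * d_s F (s, t, z)"
    "d_s G (t, s, z) = R z * d_t F (s, t, z)"
    "d_z G (t, s, z) = R z * d_z F (s, t, z) + deriv R z * F (s, t, z)"
proof -
  have z: "q (\<zeta> x) = z"
    using q_\<zeta>[OF x] px by simp
  have p\<tau>x: "p (\<tau> x) = (s, t, z)"
    using p_\<tau>[OF x] px by (simp add: swap_ts_def)
  obtain R where R: "local_rep (\<lambda>f W. f holomorphic_on W) \<Theta> q \<rho> (\<zeta> x) R"
    using \<rho>_in \<zeta>_in[OF x] by (rule analytic_funs_repE)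
  obtain F where F: "local_rep holomorphic3_on \<Omega> p f (\<tau> x) F"
    using f \<tau>_in[OF x] by (rule analytic_funs_repE)
  let ?G = "\<lambda>u. R (coord_z u) * F (swap_ts u)"
  note G = op_T_rep[OF x R F]
  have \<rho>R: "\<rho> (\<zeta> x) = R z"
    using local_rep_value[OF R] z by simp
  have "UNIV - {z. poly \<sigma> z = 0} = {z. poly \<sigma> z \<noteq> 0}"
    by auto
  then have "open (UNIV - {z. poly \<sigma> z = 0})"
    by (auto intro!: open_Collect_neq continuous_intros)
  from dz_\<Theta>_rep[OF cover_\<Theta> this R] have ode: "poly \<sigma> z * deriv R z = poly \<kappa> z * R z"
    using \<rho>_ode[OF \<zeta>_in[OF x]] z \<rho>R by simp
  obtain W where "open W" "z \<in> W" "R holomorphic_on W"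
    using R z by (elim local_repE) auto
  then have R': "(R has_derivative (\<lambda>h. deriv R z * h)) (at (coord_z (t, s, z)))"
    using holomorphic_derivI[of R W z] by (simp add: has_field_derivative_def)
  have cz: "((\<lambda>u :: complex \<times> complex \<times> complex. coord_z u) has_derivative (\<lambda>h. coord_z h)) (at (t, s, z))"
    by (auto intro!: derivative_eq_intros)
  have sw: "swap_ts = (\<lambda>u. (fst (snd u), fst u, snd (snd u)))"
    by (auto simp: swap_ts_def)
  have "(swap_ts has_derivative swap_ts) (at (t, s, z))"
    unfolding sw by (auto intro!: derivative_eq_intros)
  moreover have "(F has_derivative lin3 (grad3 F (s, t, z))) (at (swap_ts (t, s, z)))"
    using local_rep_holomorphic3D[OF F] p\<tau>x by (simp add: swap_ts_def)
  ultimately have F': "((\<lambda>u. F (swap_ts u)) has_derivative (\<lambda>h. lin3 (grad3 F (s, t, z)) (swap_ts h)))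
      (at (t, s, z))"
    by (rule has_derivative_compose)
  have "(?G has_derivative (\<lambda>h. R z * lin3 (grad3 F (s, t, z)) (swap_ts h)
      + deriv R z * coord_z h * F (s, t, z))) (at (t, s, z))"
    using has_derivative_mult[OF has_derivative_compose[OF cz R'] F'] by (simp add: swap_ts_def)
  also have "(\<lambda>h. R z * lin3 (grad3 F (s, t, z)) (swap_ts h) + deriv R z * coord_z h * F (s, t, z)) =
      lin3 (R z * d_s F (s, t, z), R z * d_t F (s, t, z), R z * d_z F (s, t, z) + deriv R z * F (s, t, z))"
    by (auto simp: fun_eq_iff grad3_def swap_ts_def algebra_simps)
  finally have "grad3 ?G (t, s, z) =
      (R z * d_s F (s, t, z), R z * d_t F (s, t, z), R z * d_z F (s, t, z) + deriv R z * F (s, t, z))"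
    by (rule grad3_eq)
  then show ?thesis
    using that[OF F G \<rho>R ode] by (simp add: grad3_def swap_ts_def)
qed

lemma op_T_eqI:
  assumes "g \<in> extensional \<Omega>" "\<And>x. x \<in> \<Omega> \<Longrightarrow> g x = \<rho> (\<zeta> x) * f (\<tau> x)"
  shows "op_T \<Omega> \<zeta> \<tau> \<rho> f = g"
  using assms by (intro extensionalityI[of _ \<Omega>]) (simp_all add: op_T_def)

lemma induced_op_extensional: "induced_op hol \<Omega> p D f \<in> extensional \<Omega>"
  by (simp add: induced_op_def)

text \<open>N has no z-derivative, so the multiplier passes through, and the swap exchanges its two
  summands.\<close>

lemma op_T_op_N:
  assumes f: "f \<in> space_A \<Omega> p"
  shows "op_T \<Omega> \<zeta> \<tau> \<rho> (op_N \<Omega> p f) = (\<lambda>x\<in>\<Omega>. - op_N \<Omega> p (op_T \<Omega> \<zeta> \<tau> \<rho> f) x)"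
proof (rule op_T_eqI)
  fix x assume x: "x \<in> \<Omega>"
  obtain t s z where px: "p x = (t, s, z)"
    by (cases "p x") auto
  have p\<tau>x: "p (\<tau> x) = (s, t, z)"
    using p_\<tau>[OF x] px by (simp add: swap_ts_def)
  obtain R F G where F: "local_rep holomorphic3_on \<Omega> p f (\<tau> x) F"
    and G: "local_rep holomorphic3_on \<Omega> p (op_T \<Omega> \<zeta> \<tau> \<rho> f) x G"
    and *: "\<rho> (\<zeta> x) = R z" "d_t G (t, s, z) = R z * d_s F (s, t, z)"
      "d_s G (t, s, z) = R z * d_t F (s, t, z)"
    by (rule op_T_derivatives[OF x px f]) (rule that)
  show "(\<lambda>x\<in>\<Omega>. - op_N \<Omega> p (op_T \<Omega> \<zeta> \<tau> \<rho> f) x) x = \<rho> (\<zeta> x) * op_N \<Omega> p f (\<tau> x)"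
    using x by (simp add: op_N_rep[OF F p\<tau>x] op_N_rep[OF G px] * algebra_simps)
qed simp

lemma op_T_op_A_plus:
  assumes f: "f \<in> space_A \<Omega> p"
  shows "op_T \<Omega> \<zeta> \<tau> \<rho> (op_A_plus \<sigma> \<Omega> p f) = op_A_minus \<sigma> (- \<kappa>) \<Omega> p (op_T \<Omega> \<zeta> \<tau> \<rho> f)"
proof (rule op_T_eqI)
  fix x assume x: "x \<in> \<Omega>"
  obtain t s z where px: "p x = (t, s, z)"
    by (cases "p x") auto
  have p\<tau>x: "p (\<tau> x) = (s, t, z)"
    using p_\<tau>[OF x] px by (simp add: swap_ts_def)
  obtain R F G where F: "local_rep holomorphic3_on \<Omega> p f (\<tau> x) F"
    and G: "local_rep holomorphic3_on \<Omega> p (op_T \<Omega> \<zeta> \<tau> \<rho> f) x G"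
    and *: "\<rho> (\<zeta> x) = R z" "poly \<sigma> z * deriv R z = poly \<kappa> z * R z"
      "G (t, s, z) = R z * F (s, t, z)" "d_t G (t, s, z) = R z * d_s F (s, t, z)"
      "d_z G (t, s, z) = R z * d_z F (s, t, z) + deriv R z * F (s, t, z)"
    by (rule op_T_derivatives[OF x px f]) (rule that)
  \<comment> \<open>The equation for R divided by t, using \<sigma> = ts. This is the term that
    -\<kappa>/t removes.\<close>
  have "s * deriv R z = poly \<kappa> z / t * R z"
    using base_point[OF x px] *(2) by (simp add: field_simps)
  then have "s * (deriv R z * F (s, t, z)) = poly \<kappa> z / t * (R z * F (s, t, z))"
    by (simp flip: mult.assoc)
  then show "op_A_minus \<sigma> (- \<kappa>) \<Omega> p (op_T \<Omega> \<zeta> \<tau> \<rho> f) x = \<rho> (\<zeta> x) * op_A_plus \<sigma> \<Omega> p f (\<tau> x)"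
    by (simp add: op_A_plus_rep[OF F p\<tau>x] op_A_minus_rep[OF G px] * distrib_left mult.left_commute)
qed (simp add: op_A_minus_def induced_op_extensional)

lemma op_T_op_A_minus:
  assumes f: "f \<in> space_A \<Omega> p"
  shows "op_T \<Omega> \<zeta> \<tau> \<rho> (op_A_minus \<sigma> \<kappa> \<Omega> p f) = op_A_plus \<sigma> \<Omega> p (op_T \<Omega> \<zeta> \<tau> \<rho> f)"
proof (rule op_T_eqI)
  fix x assume x: "x \<in> \<Omega>"
  obtain t s z where px: "p x = (t, s, z)"
    by (cases "p x") auto
  have p\<tau>x: "p (\<tau> x) = (s, t, z)"
    using p_\<tau>[OF x] px by (simp add: swap_ts_def)
  obtain R F G where F: "local_rep holomorphic3_on \<Omega> p f (\<tau> x) F"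
    and G: "local_rep holomorphic3_on \<Omega> p (op_T \<Omega> \<zeta> \<tau> \<rho> f) x G"
    and *: "\<rho> (\<zeta> x) = R z" "poly \<sigma> z * deriv R z = poly \<kappa> z * R z"
      "d_s G (t, s, z) = R z * d_t F (s, t, z)"
      "d_z G (t, s, z) = R z * d_z F (s, t, z) + deriv R z * F (s, t, z)"
    by (rule op_T_derivatives[OF x px f]) (rule that)
  \<comment> \<open>At the swapped point the pole of A_- is in s, so the equation is divided by s;
    its left side is the term that A_+ gets from the multiplier.\<close>
  have "t * deriv R z = poly \<kappa> z / s * R z"
    using base_point[OF x px] *(2) by (simp add: field_simps)
  then have "t * (deriv R z * F (s, t, z)) = poly \<kappa> z / s * (R z * F (s, t, z))"
    by (simp flip: mult.assoc)
  then show "op_A_plus \<sigma> \<Omega> p (op_T \<Omega> \<zeta> \<tau> \<rho> f) x = \<rho> (\<zeta> x) * op_A_minus \<sigma> \<kappa> \<Omega> p f (\<tau> x)"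
    by (simp add: op_A_minus_rep[OF F p\<tau>x] op_A_plus_rep[OF G px] * distrib_left mult.left_commute)
qed (simp add: op_A_plus_def induced_op_extensional)

text \<open>T exchanges the two products in the symmetrised term and preserves N^2; in \<kappa>' N
  both factors change sign. The coefficients depend only on z, which the swap fixes.\<close>

lemma op_T_casimir:
  assumes f: "f \<in> space_A \<Omega> p"
  shows "op_T \<Omega> \<zeta> \<tau> \<rho> (casimir \<sigma> \<kappa> \<Omega> p f) = casimir \<sigma> (- \<kappa>) \<Omega> p (op_T \<Omega> \<zeta> \<tau> \<rho> f)"
proof (rule op_T_eqI)
  let ?T = "op_T \<Omega> \<zeta> \<tau> \<rho>"
  have T: "?T h x = \<rho> (\<zeta> x) * h (\<tau> x)" if "x \<in> \<Omega>" for h x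
    using that by (simp add: op_T_def)
  note mem = op_N_in_space_A op_A_plus_in_space_A op_A_minus_in_space_A op_T_in_space_A[OF \<rho>_in]
  have N: "op_N \<Omega> p (?T h) = (\<lambda>x\<in>\<Omega>. - ?T (op_N \<Omega> p h) x)" if "h \<in> space_A \<Omega> p" for h
    unfolding op_T_op_N[OF that]
    by (rule extensionalityI[of _ \<Omega>]) (simp_all add: op_N_def induced_op_extensional)
  have NN: "op_N \<Omega> p (\<lambda>x\<in>\<Omega>. - ?T (op_N \<Omega> p f) x) x = ?T (op_N \<Omega> p (op_N \<Omega> p f)) x"
    if "x \<in> \<Omega>" for x
    unfolding op_N_uminus[OF mem(4)[OF mem(1)[OF f]]] N[OF mem(1)[OF f]]
    using that by simp
  fix x assume x: "x \<in> \<Omega>"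
  have z: "coord_z (p (\<tau> x)) = coord_z (p x)"
    using p_\<tau>[OF x] by (simp add: swap_ts_def case_prod_unfold)
  have "casimir \<sigma> (- \<kappa>) \<Omega> p (?T f) x =
      1 / 2 * (?T (op_A_plus \<sigma> \<Omega> p (op_A_minus \<sigma> \<kappa> \<Omega> p f)) x
        + ?T (op_A_minus \<sigma> \<kappa> \<Omega> p (op_A_plus \<sigma> \<Omega> p f)) x)
      + poly (pderiv (pderiv \<sigma>)) (coord_z (p x)) / 2 * ?T (op_N \<Omega> p (op_N \<Omega> p f)) x
      + poly (pderiv \<kappa>) (coord_z (p x)) * ?T (op_N \<Omega> p f) x"
    using x f by (simp add: casimir_def NN N op_T_op_A_plus op_T_op_A_minus mem pderiv_minus)
  then show "casimir \<sigma> (- \<kappa>) \<Omega> p (?T f) x = \<rho> (\<zeta> x) * casimir \<sigma> \<kappa> \<Omega> p f (\<tau> x)"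
    using \<tau>_in[OF x] by (simp add: T[OF x] casimir_def z algebra_simps)
qed (simp add: casimir_def)

end

theorem theorem2p1:
  fixes \<sigma> \<kappa> :: "complex poly"
    and \<Omega> :: "'a::topological_space set"
    and p :: "'a \<Rightarrow> complex \<times> complex \<times> complex"
    and \<Theta> :: "'b::topological_space set"
    and q :: "'b \<Rightarrow> complex"
    and lw :: "'a \<Rightarrow> complex" and \<zeta> :: "'a \<Rightarrow> 'b"
    and L :: "'b \<Rightarrow> complex" and \<tau> :: "'a \<Rightarrow> 'a"
    and \<rho> :: "'b \<Rightarrow> complex"
  assumes "degree \<sigma> \<le> 2" and "\<sigma> \<noteq> 0" and "degree \<kappa> \<le> 1"
    and "universal_cover \<Omega> p (base_surface \<sigma>)"
    and "universal_cover \<Theta> q (UNIV - {z. poly \<sigma> z = 0})"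
    and "cover_coordinates \<Omega> p \<Theta> q lw \<zeta>"
    and "log_branch \<sigma> \<Theta> q L"
    and "lifted_swap \<Omega> p lw \<zeta> L \<tau>"
    and "\<rho> \<in> space_A\<Theta> \<Theta> q" and "\<exists>\<theta>\<in>\<Theta>. \<rho> \<theta> \<noteq> 0"
    and "\<forall>\<theta>\<in>\<Theta>. poly \<sigma> (q \<theta>) * dz_\<Theta> \<Theta> q \<rho> \<theta> - poly \<kappa> (q \<theta>) * \<rho> \<theta> = 0"
  shows
    "let A = space_A \<Omega> p; T = op_T \<Omega> \<zeta> \<tau> \<rho>; Tinv = inv_into A T in
       bij_betw T A A \<and>
       (\<forall>g\<in>A.
          T (op_N \<Omega> p (Tinv g)) = (\<lambda>x\<in>\<Omega>. - op_N \<Omega> p g x) \<and>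
          T (op_A_plus \<sigma> \<Omega> p (Tinv g)) = op_A_minus \<sigma> (- \<kappa>) \<Omega> p g \<and>
          T (op_A_minus \<sigma> \<kappa> \<Omega> p (Tinv g)) = op_A_plus \<sigma> \<Omega> p g \<and>
          T (casimir \<sigma> \<kappa> \<Omega> p (Tinv g)) = casimir \<sigma> (- \<kappa>) \<Omega> p g)"
proof -
  have coords: "continuous_on \<Omega> \<zeta>" "\<zeta> \<in> \<Omega> \<rightarrow> \<Theta>" "\<forall>x\<in>\<Omega>. q (\<zeta> x) = coord_z (p x)"
    using assms(6) by (auto simp: cover_coordinates_def)
  have swap: "continuous_on \<Omega> \<tau>" "\<tau> \<in> \<Omega> \<rightarrow> \<Omega>" "\<forall>x\<in>\<Omega>. \<tau> (\<tau> x) = x"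
    "\<forall>x\<in>\<Omega>. p (\<tau> x) = swap_ts (p x)" "\<forall>x\<in>\<Omega>. \<zeta> (\<tau> x) = \<zeta> x"
    using assms(8) by (auto simp: lifted_swap_def)
  interpret twisted_swap \<sigma> \<Omega> p \<Theta> q \<zeta> \<tau> \<kappa> \<rho>
    using assms(4,5,9,11) coords swap linear_ode_solution_nonzero[OF assms(5,9,10,11)]
    by unfold_locales auto
  let ?A = "space_A \<Omega> p" and ?T = "op_T \<Omega> \<zeta> \<tau> \<rho>"
  \<comment> \<open>The commutation relations are applied to the preimage f of g, where T f = g
    turns them into conjugation identities.\<close>
  have inv: "inv_into ?A ?T g \<in> ?A" "?T (inv_into ?A ?T g) = g" if "g \<in> ?A" for g
    using bij_betw_op_T that
    by (auto simp: bij_betw_def f_inv_into_f intro: inv_into_into)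
  show ?thesis
    unfolding Let_def
    by (simp add: bij_betw_op_T inv op_T_op_N op_T_op_A_plus op_T_op_A_minus op_T_casimir)
qed

end
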